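(* Let $\alpha\in\mathbb R\setminus\{0\}$, $p(\xi)=\dfrac{2}{(1+\xi^2)^2}$, $q(\xi)=(\arctan\xi)^\alpha$ for $\xi>0$, and let $x$ be a circular solution of radius $\xi_0$ of the Lagrangian system with $L=\frac12p(\xi)[\dot\xi^2+\xi^2\dot\vartheta^2]+q(\xi)$, so that $(\xi_0,\alpha)\in\Omega_1\cup\Omega_2$ where $\Omega_1=(1,+\infty)\times(0,+\infty)$ and $\Omega_2=(0,1)\times(-\infty,0)$. With the regions defined in the context, the Morse index of $x$ takes values between $0$ and $3$ and is given by $$m^-(x)=\begin{cases} 0 &\text{if }(\xi_0,\alpha)\in\Omega_1^-\cup\Omega_1^0\cup\Omega_{1,0}^{+,+}\cup\Omega_{1,0}^{+,0}\cup\Omega_2^-\cup\Omega_2^0\cup\Omega_{2,0}^{+,+}\cup\Omega_{2,0}^{+,0},\\ 1 &\text{if }(\xi_0,\alpha)\in\Omega_{1,0}^{+,-}\cup\Omega_{2,0}^{+,-},\\ 2 &\text{if }(\xi_0,\alpha)\in\Omega_{1,1}^{+,+}\cup\Omega_{1,1}^{+,0}\cup\Omega_{2,1}^{+,+}\cup\Omega_{2,1}^{+,0},\\ 3 &\text{if }(\xi_0,\alpha)\in\Omega_{1,1}^{+,-}\cup\Omega_{2,1}^{+,-}. \end{cases}$$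
   Context: Circular solution: a solution $x(t)=(\xi_0,\vartheta_0+\dot\vartheta_0t)$ of the Euler–Lagrange equations of $L$, $(\xi,\vartheta)$ polar coordinates, with constant $\xi_0>0$ and constant $\dot\vartheta_0>0$, where $\dot\vartheta_0^2=-2q'(\xi_0)/\eta'(\xi_0)$, $\eta(\xi)=p(\xi)\xi^2$, $\eta'(\xi_0)\ne0$; its prime period is $T=2\pi/\dot\vartheta_0$. Morse index: $m^-(x)$ is the maximal dimension of a subspace of $W^{1,2}(\mathbb R/T\mathbb Z,\mathbb R^2)$ on which $I(u,u)=\int_0^T\langle P\dot u,\dot u\rangle+2\langle Qu,\dot u\rangle+\langle Ru,u\rangle\,dt$ is negative definite, where $P=L_{vv}$, $Q=L_{vx}$, $R=L_{xx}$ are evaluated along $x$ (second variation of the action $\int_0^TL\,dt$ on $T$-periodic $H^1$ loops in the punctured plane). Regions: put $$f_1(\xi,\alpha)=(3\xi^4-2\xi^2+3)\arctan\xi+(\alpha-1)\xi(1-\xi^2),$$ $$f_2(\xi,\alpha)=(\xi^4-6\xi^2+1)\arctan\xi-(\alpha-1)\xi(1-\xi^2).$$ For $i=1,2$: $\Omega_i^{\pm}=\{(\xi,\alpha)\in\Omega_i:\ \pm f_1>0\}$, $\Omega_i^0=\{(\xi,\alpha)\in\Omega_i:\ f_1=0\}$, $\Omega_i^{+,\pm}=\{(\xi,\alpha)\in\Omega_i^+:\ \pm f_2>0\}$, $\Omega_i^{+,0}=\{(\xi,\alpha)\in\Omega_i^+:\ f_2=0\}$. For $*\in\{+,-,0\}$: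 $$\Omega_{1,0}^{+,*}=\Big\{(\xi,\alpha)\in\Omega_1^{+,*}:\ \alpha\ge1+\tfrac{2(\xi^2-1)\arctan\xi}{\xi}\Big\},\quad \Omega_{1,1}^{+,*}=\Big\{(\xi,\alpha)\in\Omega_1^{+,*}:\ 0<\alpha<1+\tfrac{2(\xi^2-1)\arctan\xi}{\xi}\Big\},$$ $$\Omega_{2,0}^{+,*}=\Big\{(\xi,\alpha)\in\Omega_2^{+,*}:\ \alpha\le1-\tfrac{2(1-\xi^2)\arctan\xi}{\xi}\Big\},\quad \Omega_{2,1}^{+,*}=\Big\{(\xi,\alpha)\in\Omega_2^{+,*}:\ 1-\tfrac{2(1-\xi^2)\arctan\xi}{\xi}<\alpha<0\Big\}.$$ *)

theory Defs
  imports "HOL-Analysis.Analysis" "HOL-Library.Extended_Nat"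
begin

section \<open>Lagrangian systems on the plane\<close>

definition partial_deriv :: "'n::finite \<Rightarrow> (real ^ 'n \<Rightarrow> real) \<Rightarrow> real ^ 'n \<Rightarrow> real" where
  "partial_deriv i f x = deriv (\<lambda>s. f (x + s *\<^sub>R axis i 1)) 0"

text \<open>A Lagrangian takes a position and a velocity, in this order, both in the same
  coordinates. The curve \<open>x\<close> is given in these coordinates as well.\<close>

type_synonym lagrangian = "real ^ 2 \<Rightarrow> real ^ 2 \<Rightarrow> real"

definition velocity :: "(real \<Rightarrow> real ^ 2) \<Rightarrow> real \<Rightarrow> real ^ 2" where
  "velocity x t = vector_derivative x (at t)"

definition euler_lagrange :: "lagrangian \<Rightarrow> (real \<Rightarrow> real ^ 2) \<Rightarrow> bool" where
  "euler_lagrange L x \<longleftrightarrow>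
     (\<forall>t. x differentiable (at t)) \<and>
     (\<forall>t i. ((\<lambda>s. partial_deriv i (L (x s)) (velocity x s)) has_real_derivative
               partial_deriv i (\<lambda>y. L y (velocity x t)) (x t)) (at t))"

text \<open>The matrices \<open>L\<^sub>v\<^sub>v\<close>, \<open>L\<^sub>v\<^sub>x\<close> and \<open>L\<^sub>x\<^sub>x\<close>. The row index of \<open>L\<^sub>v\<^sub>x\<close> belongs to \<open>v\<close>
  and the column index to \<open>x\<close>, so that \<open>\<langle>Q u, w\<rangle>\<close> pairs the variation \<open>u\<close> of the position with
  the variation \<open>w\<close> of the velocity.\<close>

definition L_vv :: "lagrangian \<Rightarrow> real ^ 2 \<Rightarrow> real ^ 2 \<Rightarrow> real ^ 2 ^ 2" where
  "L_vv L x v = (\<chi> i j. partial_deriv j (\<lambda>w. partial_deriv i (L x) w) v)"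

definition L_vx :: "lagrangian \<Rightarrow> real ^ 2 \<Rightarrow> real ^ 2 \<Rightarrow> real ^ 2 ^ 2" where
  "L_vx L x v = (\<chi> i j. partial_deriv j (\<lambda>y. partial_deriv i (L y) v) x)"

definition L_xx :: "lagrangian \<Rightarrow> real ^ 2 \<Rightarrow> real ^ 2 \<Rightarrow> real ^ 2 ^ 2" where
  "L_xx L x v = (\<chi> i j. partial_deriv j (\<lambda>y. partial_deriv i (\<lambda>z. L z v) y) x)"


section \<open>Periodic Sobolev loops and the Morse index\<close>

text \<open>Elements of \<open>W\<^sup>1\<^sup>,\<^sup>2(\<real>/T\<int>, \<real>\<^sup>2)\<close> are represented by their absolutely continuous
  representatives. Since these are continuous and periodic, hence bounded, they live in the
  vector space of bounded continuous functions, which supplies \<open>subspace\<close>, \<open>span\<close> and \<open>dim\<close>.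
  The weak derivative is determined up to null sets only; all uses below are under an integral.\<close>

definition has_weak_deriv :: "real \<Rightarrow> (real \<Rightarrow> real ^ 2) \<Rightarrow> (real \<Rightarrow> real ^ 2) \<Rightarrow> bool" where
  "has_weak_deriv T u w \<longleftrightarrow>
     set_integrable lborel {0..T} w \<and>
     set_integrable lborel {0..T} (\<lambda>t. (norm (w t))\<^sup>2) \<and>
     (\<forall>t\<in>{0..T}. u t = u 0 + (LBINT s:{0..t}. w s))"

definition weak_deriv :: "real \<Rightarrow> (real \<Rightarrow> real ^ 2) \<Rightarrow> real \<Rightarrow> real ^ 2" where
  "weak_deriv T u = (SOME w. has_weak_deriv T u w)"

definition sobolev_loops :: "real \<Rightarrow> (real \<Rightarrow>\<^sub>C (real ^ 2)) set" where
  "sobolev_loops T =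
     {u. (\<forall>t. apply_bcontfun u (t + T) = apply_bcontfun u t) \<and>
         (\<exists>w. has_weak_deriv T (apply_bcontfun u) w)}"

definition index_form ::
    "lagrangian \<Rightarrow> (real \<Rightarrow> real ^ 2) \<Rightarrow> real \<Rightarrow> (real \<Rightarrow> real ^ 2) \<Rightarrow> real" where
  "index_form L x T u =
     (LBINT t:{0..T}.
        (L_vv L (x t) (velocity x t) *v weak_deriv T u t) \<bullet> weak_deriv T u t
        + 2 * ((L_vx L (x t) (velocity x t) *v u t) \<bullet> weak_deriv T u t)
        + (L_xx L (x t) (velocity x t) *v u t) \<bullet> u t)"

text \<open>Restricting to finite-dimensional \<open>V\<close> is needed because \<open>dim\<close> is not meaningful otherwise;
  an infinite-dimensional negative definite subspace still yields the value \<open>\<infinity>\<close>, because it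
  contains finite-dimensional ones of every dimension.\<close>

definition morse_index :: "lagrangian \<Rightarrow> (real \<Rightarrow> real ^ 2) \<Rightarrow> real \<Rightarrow> enat" where
  "morse_index L x T =
     Sup {enat (dim V) | V.
            subspace V \<and> (\<exists>B. finite B \<and> V \<subseteq> span B) \<and> V \<subseteq> sobolev_loops T \<and>
            (\<forall>u\<in>V. u \<noteq> 0 \<longrightarrow> index_form L x T (apply_bcontfun u) < 0)}"


section \<open>Circular solutions in polar coordinates\<close>

text \<open>Component 1 is the radius \<open>\<xi>\<close> and component 2 the angle \<open>\<theta>\<close>. The curve itself is periodic
  only up to \<open>2\<pi>\<close> in the angle, but the coordinate frame along the corresponding loop in the
  punctured plane is periodic, so that the variations of the loop are exactly the periodic
  functions in these coordinates.\<close>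

definition polar_lagrangian :: "(real \<Rightarrow> real) \<Rightarrow> (real \<Rightarrow> real) \<Rightarrow> lagrangian" where
  "polar_lagrangian p q z v =
     1/2 * p (z $ 1) * ((v $ 1)\<^sup>2 + (z $ 1)\<^sup>2 * (v $ 2)\<^sup>2) + q (z $ 1)"

definition circular_curve :: "real \<Rightarrow> real \<Rightarrow> real \<Rightarrow> real \<Rightarrow> real ^ 2" where
  "circular_curve \<xi>0 \<theta>0 \<omega> t = vector [\<xi>0, \<theta>0 + \<omega> * t]"

definition eta :: "(real \<Rightarrow> real) \<Rightarrow> real \<Rightarrow> real" where
  "eta p \<xi> = p \<xi> * \<xi>\<^sup>2"

text \<open>For \<open>p\<close> and \<open>q\<close> differentiable at \<open>\<xi>0\<close>, the formula for \<open>\<omega>\<^sup>2\<close> is the radial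
  Euler--Lagrange equation solved for \<open>\<omega>\<^sup>2\<close>, so that it does not restrict the solutions any
  further.\<close>

definition circular_solution ::
    "(real \<Rightarrow> real) \<Rightarrow> (real \<Rightarrow> real) \<Rightarrow> real \<Rightarrow> real \<Rightarrow> real \<Rightarrow> bool" where
  "circular_solution p q \<xi>0 \<theta>0 \<omega> \<longleftrightarrow>
     \<xi>0 > 0 \<and> \<omega> > 0 \<and>
     euler_lagrange (polar_lagrangian p q) (circular_curve \<xi>0 \<theta>0 \<omega>) \<and>
     deriv (eta p) \<xi>0 \<noteq> 0 \<and>
     \<omega>\<^sup>2 = - 2 * deriv q \<xi>0 / deriv (eta p) \<xi>0"


section \<open>The conformal factor, the potential and the parameter regions\<close>

definition conf_factor :: "real \<Rightarrow> real" where
  "conf_factor \<xi> = 2 / (1 + \<xi>\<^sup>2)\<^sup>2"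

definition arctan_potential :: "real \<Rightarrow> real \<Rightarrow> real" where
  "arctan_potential \<alpha> \<xi> = arctan \<xi> powr \<alpha>"

definition f1 :: "real \<Rightarrow> real \<Rightarrow> real" where
  "f1 \<xi> \<alpha> = (3 * \<xi>^4 - 2 * \<xi>\<^sup>2 + 3) * arctan \<xi> + (\<alpha> - 1) * \<xi> * (1 - \<xi>\<^sup>2)"

definition f2 :: "real \<Rightarrow> real \<Rightarrow> real" where
  "f2 \<xi> \<alpha> = (\<xi>^4 - 6 * \<xi>\<^sup>2 + 1) * arctan \<xi> - (\<alpha> - 1) * \<xi> * (1 - \<xi>\<^sup>2)"

definition Omega1 :: "(real \<times> real) set" where
  "Omega1 = {1<..} \<times> {0<..}"

definition Omega2 :: "(real \<times> real) set" where
  "Omega2 = {0<..<1} \<times> {..<0}"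

text \<open>For \<open>S = \<Omega>\<^sub>i\<close> these are \<open>\<Omega>\<^sub>i\<close> with upper index \<open>+\<close>, \<open>-\<close>, \<open>0\<close> and then
  \<open>+,+\<close>, \<open>+,-\<close>, \<open>+,0\<close>.\<close>

definition reg_p :: "(real \<times> real) set \<Rightarrow> (real \<times> real) set" where
  "reg_p S = {(\<xi>, \<alpha>). (\<xi>, \<alpha>) \<in> S \<and> f1 \<xi> \<alpha> > 0}"

definition reg_m :: "(real \<times> real) set \<Rightarrow> (real \<times> real) set" where
  "reg_m S = {(\<xi>, \<alpha>). (\<xi>, \<alpha>) \<in> S \<and> - f1 \<xi> \<alpha> > 0}"

definition reg_0 :: "(real \<times> real) set \<Rightarrow> (real \<times> real) set" where
  "reg_0 S = {(\<xi>, \<alpha>). (\<xi>, \<alpha>) \<in> S \<and> f1 \<xi> \<alpha> = 0}"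

definition reg_pp :: "(real \<times> real) set \<Rightarrow> (real \<times> real) set" where
  "reg_pp S = {(\<xi>, \<alpha>). (\<xi>, \<alpha>) \<in> reg_p S \<and> f2 \<xi> \<alpha> > 0}"

definition reg_pm :: "(real \<times> real) set \<Rightarrow> (real \<times> real) set" where
  "reg_pm S = {(\<xi>, \<alpha>). (\<xi>, \<alpha>) \<in> reg_p S \<and> - f2 \<xi> \<alpha> > 0}"

definition reg_p0 :: "(real \<times> real) set \<Rightarrow> (real \<times> real) set" where
  "reg_p0 S = {(\<xi>, \<alpha>). (\<xi>, \<alpha>) \<in> reg_p S \<and> f2 \<xi> \<alpha> = 0}"

text \<open>The lower indices \<open>1,0\<close>, \<open>1,1\<close>, \<open>2,0\<close>, \<open>2,1\<close>, to be applied to the sets with upper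
  index \<open>+,*\<close>.\<close>

definition sub_10 :: "(real \<times> real) set \<Rightarrow> (real \<times> real) set" where
  "sub_10 S = {(\<xi>, \<alpha>). (\<xi>, \<alpha>) \<in> S \<and> \<alpha> \<ge> 1 + 2 * (\<xi>\<^sup>2 - 1) * arctan \<xi> / \<xi>}"

definition sub_11 :: "(real \<times> real) set \<Rightarrow> (real \<times> real) set" where
  "sub_11 S = {(\<xi>, \<alpha>). (\<xi>, \<alpha>) \<in> S \<and> 0 < \<alpha> \<and> \<alpha> < 1 + 2 * (\<xi>\<^sup>2 - 1) * arctan \<xi> / \<xi>}"

definition sub_20 :: "(real \<times> real) set \<Rightarrow> (real \<times> real) set" where
  "sub_20 S = {(\<xi>, \<alpha>). (\<xi>, \<alpha>) \<in> S \<and> \<alpha> \<le> 1 - 2 * (1 - \<xi>\<^sup>2) * arctan \<xi> / \<xi>}"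

definition sub_21 :: "(real \<times> real) set \<Rightarrow> (real \<times> real) set" where
  "sub_21 S = {(\<xi>, \<alpha>). (\<xi>, \<alpha>) \<in> S \<and> 1 - 2 * (1 - \<xi>\<^sup>2) * arctan \<xi> / \<xi> < \<alpha> \<and> \<alpha> < 0}"

end

theory Submission
  imports Defs
begin

text \<open>Along a circular solution the index form has constant coefficients. Completing the square in
  the angular velocity decouples it: since the angle is periodic, all harmonics of its velocity
  except the mean can be chosen to make the square vanish. With \<open>\<eta> = p(\<xi>) \<xi>\<^sup>2\<close> and
  \<open>c = \<eta>'' \<omega>\<^sup>2 / 2 + q''\<close>, the radial mean thus carries the weight \<open>c\<close> and the two radial
  harmonics of order \<open>k \<ge> 1\<close> carry \<open>p k\<^sup>2 \<omega>\<^sup>2 + c - \<eta>'\<^sup>2 \<omega>\<^sup>2 / \<eta>\<close>, and the Morse index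
  counts the negative weights. The upper bound is Wirtinger's inequality on the complement of the
  negative harmonics. For the given \<open>p\<close> and \<open>q\<close> the weight \<open>c\<close> has the sign of \<open>f\<^sub>2\<close>, the weight
  formula at \<open>k = 0\<close> has the sign of \<open>- f\<^sub>1\<close>, the weight for \<open>k = 1\<close> changes sign on the
  bounding curves of the regions with lower indices \<open>1,0\<close>, \<open>1,1\<close>, \<open>2,0\<close>, \<open>2,1\<close>, and the weight
  for \<open>k = 2\<close> is never negative.\<close>

section \<open>Trigonometric approximation in the Hartley system\<close>

text \<open>The form is evaluated through \<open>weak_deriv\<close>, an arbitrary choice among
  functions that agree almost everywhere. The upper bound works with whichever derivative was
  chosen, but evaluating the form on an explicit loop requires that weak derivatives be unique up to
  null sets. No spectral theory and no convergent Fourier series occur. If a subspace has dimension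
  above the number of negative weights, finitely many linear conditions leave in it a nonzero loop
  whose radial component has no coefficient at the negative harmonics, and on that loop the form is
  nonnegative. The estimate behind this comes from Bessel's inequality for the derivative and
  uniform trigonometric approximation of the loop itself; together they stand in for Parseval's
  identity and keep all sums finite. Zero weights count as nonnegative, which is why the boundary
  cases \<open>f2 = 0\<close> and equality in the bounds on \<open>\<alpha>\<close> fall to the
  smaller index.\<close>

text \<open>Taking \<open>cos + sin\<close> turns the trigonometric system into a single orthogonal family indexed
  by \<open>int\<close>, closed under products and, up to \<open>k \<mapsto> - k\<close>, under differentiation.\<close>

definition hartley :: "real \<Rightarrow> int \<Rightarrow> real \<Rightarrow> real" where
  "hartley \<omega> k t = cos (of_int k * \<omega> * t) + sin (of_int k * \<omega> * t)"

lemma hartley_0 [simp]: "hartley \<omega> 0 t = 1"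
  by (simp add: hartley_def)

lemma continuous_on_hartley [continuous_intros]: "continuous_on S (hartley \<omega> k)"
  unfolding hartley_def [abs_def] by (intro continuous_intros)

lemma hartley_has_real_derivative [derivative_intros]:
  "(hartley \<omega> k has_real_derivative of_int k * \<omega> * hartley \<omega> (- k) t) (at t)"
  unfolding hartley_def [abs_def]
  by (auto intro!: derivative_eq_intros simp: algebra_simps)

lemma hartley_periodic:
  assumes "\<omega> \<noteq> 0"
  shows "hartley \<omega> k (t + 2 * pi / \<omega>) = hartley \<omega> k t"
proof -
  have *: "of_int k * \<omega> * (t + 2 * pi / \<omega>) = of_int k * \<omega> * t + 2 * pi * of_int k"
    using assms by (simp add: field_simps)
  show ?thesis
    unfolding hartley_def * by (simp add: sin_add cos_add)
qed

lemma abs_hartley_le: "\<bar>hartley \<omega> k t\<bar> \<le> 2"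
  unfolding hartley_def
  using abs_cos_le_one [of "of_int k * \<omega> * t"] abs_sin_le_one [of "of_int k * \<omega> * t"] by linarith

text \<open>With cas = cos + sin, cas a * cas b = cos (a - b) + sin (a + b). The cosine is half the
  sum of two Hartley functions of opposite orders, the sine half the difference of two such.\<close>

lemma hartley_mult:
  "hartley \<omega> j t * hartley \<omega> k t =
     (hartley \<omega> (j - k) t + hartley \<omega> (k - j) t + hartley \<omega> (j + k) t - hartley \<omega> (- j - k) t) / 2"
proof -
  define a b where "a = of_int j * \<omega> * t" and "b = of_int k * \<omega> * t"
  have 1: "of_int (j - k) * \<omega> * t = a - b" "of_int (k - j) * \<omega> * t = b - a"
    "of_int (j + k) * \<omega> * t = a + b" "of_int (- j - k) * \<omega> * t = - (a + b)"
    by (simp_all add: a_def b_def algebra_simps)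
  show ?thesis
    unfolding hartley_def 1 a_def [symmetric] b_def [symmetric]
    by (simp add: sin_add sin_diff cos_add cos_diff algebra_simps)
qed

definition trig_polys :: "real \<Rightarrow> (real \<Rightarrow> real) set" where
  "trig_polys \<omega> = {f. \<exists>F c. finite F \<and> f = (\<lambda>t. \<Sum>k\<in>F. c k * hartley \<omega> k t)}"

lemma trig_polys_add:
  assumes "f \<in> trig_polys \<omega>" "g \<in> trig_polys \<omega>"
  shows "(\<lambda>t. f t + g t) \<in> trig_polys \<omega>"
proof -
  obtain F c where F: "finite F" "f = (\<lambda>t. \<Sum>k\<in>F. c k * hartley \<omega> k t)"
    using assms unfolding trig_polys_def by auto
  obtain G d where G: "finite G" "g = (\<lambda>t. \<Sum>k\<in>G. d k * hartley \<omega> k t)"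
    using assms unfolding trig_polys_def by auto
  define e where "e k = (if k \<in> F then c k else 0) + (if k \<in> G then d k else 0)" for k
  have "f t + g t = (\<Sum>k\<in>F \<union> G. e k * hartley \<omega> k t)" for t
  proof -
    have "f t = (\<Sum>k\<in>F \<union> G. (if k \<in> F then c k else 0) * hartley \<omega> k t)"
      unfolding F by (rule sum.mono_neutral_cong_left) (use F G in auto)
    moreover have "g t = (\<Sum>k\<in>F \<union> G. (if k \<in> G then d k else 0) * hartley \<omega> k t)"
      unfolding G by (rule sum.mono_neutral_cong_left) (use F G in auto)
    ultimately show ?thesis
      by (simp add: e_def algebra_simps sum.distrib)
  qed
  then show ?thesis
    unfolding trig_polys_def using F G by blast
qed

lemma trig_polys_scale: "f \<in> trig_polys \<omega> \<Longrightarrow> (\<lambda>t. a * f t) \<in> trig_polys \<omega>"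
  unfolding trig_polys_def
  by (force simp: sum_distrib_left mult.assoc intro!: exI [of _ "\<lambda>k. a * c k" for c])

lemma hartley_in_trig_polys: "hartley \<omega> k \<in> trig_polys \<omega>"
  unfolding trig_polys_def by (auto intro!: exI [of _ "{k}"] exI [of _ "\<lambda>_. 1"])

lemma trig_polys_sum:
  "finite F \<Longrightarrow> (\<And>k. k \<in> F \<Longrightarrow> f k \<in> trig_polys \<omega>) \<Longrightarrow> (\<lambda>t. \<Sum>k\<in>F. f k t) \<in> trig_polys \<omega>"
proof (induction F rule: finite_induct)
  case empty
  then show ?case using trig_polys_scale [OF hartley_in_trig_polys, of 0 \<omega>] by simp
next
  case (insert x F)
  then show ?case by (simp add: trig_polys_add)
qed

lemma hartley_mult_in_trig_polys: "(\<lambda>t. hartley \<omega> j t * hartley \<omega> k t) \<in> trig_polys \<omega>"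
proof -
  have "(\<lambda>t. (1/2) * (hartley \<omega> (j - k) t + hartley \<omega> (k - j) t
          + hartley \<omega> (j + k) t + (-1) * hartley \<omega> (- j - k) t)) \<in> trig_polys \<omega>"
    by (intro trig_polys_add trig_polys_scale hartley_in_trig_polys)
  also have "(\<lambda>t. (1/2) * (hartley \<omega> (j - k) t + hartley \<omega> (k - j) t
          + hartley \<omega> (j + k) t + (-1) * hartley \<omega> (- j - k) t))
      = (\<lambda>t. hartley \<omega> j t * hartley \<omega> k t)"
    by (rule ext, subst hartley_mult) simp
  finally show ?thesis .
qed

lemma trig_polys_mult:
  assumes "f \<in> trig_polys \<omega>" "g \<in> trig_polys \<omega>"
  shows "(\<lambda>t. f t * g t) \<in> trig_polys \<omega>"
proof -
  obtain F c where F: "finite F" "f = (\<lambda>t. \<Sum>k\<in>F. c k * hartley \<omega> k t)"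
    using assms unfolding trig_polys_def by auto
  obtain G d where G: "finite G" "g = (\<lambda>t. \<Sum>k\<in>G. d k * hartley \<omega> k t)"
    using assms unfolding trig_polys_def by auto
  have "(\<lambda>t. \<Sum>j\<in>F. \<Sum>k\<in>G. (c j * d k) * (hartley \<omega> j t * hartley \<omega> k t)) \<in> trig_polys \<omega>"
    by (intro trig_polys_sum F G trig_polys_scale hartley_mult_in_trig_polys)
  then show ?thesis
    unfolding F G by (simp add: sum_product mult.assoc mult.left_commute)
qed

lemma trig_polys_const: "(\<lambda>t. a) \<in> trig_polys \<omega>"
  using trig_polys_scale [OF hartley_in_trig_polys, of a \<omega> 0] by simp

section \<open>Periodic functions on the unit circle and Stone-Weierstrass\<close>

lemma periodic_add_int:
  fixes g :: "real \<Rightarrow> 'a"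
  assumes "\<And>t. g (t + a) = g t"
  shows "g (t + of_int n * a) = g t"
proof (induction n rule: int_induct [where k = 0])
  case (step1 i)
  then show ?case
    using assms [of "t + of_int i * a"] by (simp add: algebra_simps)
next
  case (step2 i)
  then show ?case
    using assms [of "t + of_int (i - 1) * a"] by (simp add: algebra_simps)
qed simp

text \<open>Moves a periodic function to a compact set, where Stone-Weierstrass applies.
  \<open>Arg\<close> jumps on the negative real axis, but by a period of \<open>g\<close>: away from
  0, \<open>g (Arg z)\<close> also equals \<open>g (Arg (- z) + pi)\<close>, which is continuous
  there because \<open>- z\<close> lies off the cut.\<close>

lemma continuous_on_sphere_Arg:
  fixes g :: "real \<Rightarrow> real"
  assumes cont: "continuous_on UNIV g" and per: "\<And>t. g (t + 2 * pi) = g t"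
  shows "continuous_on (sphere 0 1) (\<lambda>z. g (Arg z))" and "g (Arg (cis t)) = g t"
proof -
  have eq: "g s = g t" if "cis s = cis t" for s t
  proof -
    have "sin s = sin t \<and> cos s = cos t"
      using that by (simp add: complex_eq_iff)
    then obtain n :: int where "s = t + of_int n * (2 * pi)"
      unfolding sin_cos_eq_iff by (auto simp: mult_ac)
    then show ?thesis using periodic_add_int [of g, OF per] by simp
  qed
  show "g (Arg (cis t)) = g t"
    by (rule eq) (simp add: cis_Arg sgn_eq)
  have g: "isCont g s" for s
    using cont by (simp add: continuous_on_eq_continuous_at)
  have "isCont (\<lambda>z. g (Arg z)) z" if "z \<in> sphere 0 1" for z
  proof (cases "z \<in> \<real>\<^sub>\<le>\<^sub>0")
    case False
    show ?thesis
      by (rule isCont_o2 [OF continuous_at_Arg [OF False] g])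
  next
    have z: "z \<noteq> 0" using that by auto
    case True
    then have nz: "- z \<notin> \<real>\<^sub>\<le>\<^sub>0"
      using z by (auto elim!: nonpos_Reals_cases)
    have "isCont (\<lambda>z. Arg (- z)) z"
      using continuous_at_Arg [OF nz] by (intro isCont_o2 [of z uminus Arg]) auto
    then have c: "isCont (\<lambda>z. g (Arg (- z) + pi)) z"
      by (intro isCont_o2 [OF _ g] continuous_intros)
    have "g (Arg w) = g (Arg (- w) + pi)" if "w \<noteq> 0" for w
    proof (rule eq)
      have "cis (Arg (- w) + pi) = - cis (Arg (- w))"
        by (simp add: cis_mult [symmetric])
      also have "\<dots> = cis (Arg w)"
        using that by (simp add: cis_Arg sgn_minus)
      finally show "cis (Arg w) = cis (Arg (- w) + pi)" ..
    qed
    then have "\<forall>\<^sub>F w in nhds z. g (Arg (- w) + pi) = g (Arg w)"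
      using t1_space_nhds [OF z] by (auto elim!: eventually_mono)
    with c show ?thesis
      by (simp add: isCont_cong)
  qed
  then show "continuous_on (sphere 0 1) (\<lambda>z. g (Arg z))"
    by (intro continuous_at_imp_continuous_on ballI)
qed

theorem trig_poly_approximation:
  fixes v :: "real \<Rightarrow> real"
  assumes \<omega>: "\<omega> \<noteq> 0" and cont: "continuous_on UNIV v"
    and per: "\<And>t. v (t + 2 * pi / \<omega>) = v t" and e: "e > 0"
  obtains F c where "finite F" "\<And>t. \<bar>v t - (\<Sum>k\<in>F. c k * hartley \<omega> k t)\<bar> < e"
proof -
  define g where "g s = v (s / \<omega>)" for s
  have contg: "continuous_on UNIV g"
    unfolding g_def using \<omega> by (intro continuous_on_compose2 [OF cont] continuous_intros) auto
  have perg: "g (t + 2 * pi) = g t" for t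
    using per [of "t / \<omega>"] by (simp add: g_def add_divide_distrib)
  \<comment> \<open>The approximating algebra: besides continuity, only the pullback along
    \<open>cis\<close> is required to be a trigonometric polynomial. It separates points because it
    contains \<open>Re\<close> and \<open>Im\<close>, which on the circle are the half sum and half
    difference of the orders 1 and -1.\<close>
  define R :: "(complex \<Rightarrow> real) set"
    where "R = {f. continuous_on (sphere 0 1) f \<and> (\<lambda>t. f (cis t)) \<in> trig_polys 1}"
  have Re: "Re \<in> R"
  proof -
    have "(\<lambda>t. (1/2) * (hartley 1 1 t + hartley 1 (-1) t)) \<in> trig_polys 1"
      by (intro trig_polys_add trig_polys_scale hartley_in_trig_polys)
    then show ?thesis
      by (simp add: R_def hartley_def continuous_on_Re continuous_on_id)
  qed
  have Im: "Im \<in> R"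
  proof -
    have "(\<lambda>t. (1/2) * (hartley 1 1 t + (-1) * hartley 1 (-1) t)) \<in> trig_polys 1"
      by (intro trig_polys_add trig_polys_scale hartley_in_trig_polys)
    then show ?thesis
      by (simp add: R_def hartley_def continuous_on_Im continuous_on_id)
  qed
  interpret function_ring_on R "sphere 0 1"
  proof
    show "\<exists>f\<in>R. f x \<noteq> f y" if "x \<noteq> y" for x y
      using that Re Im complex_eqI by blast
  qed (auto simp: R_def trig_polys_add trig_polys_mult trig_polys_const intro!: continuous_intros)
  obtain f where f: "f \<in> R" and fe: "\<And>z. z \<in> sphere 0 1 \<Longrightarrow> \<bar>g (Arg z) - f z\<bar> < e"
    using Stone_Weierstrass_basic [OF continuous_on_sphere_Arg(1) [OF contg perg] e] by blast
  obtain F c where F: "finite F" "\<And>t. f (cis t) = (\<Sum>k\<in>F. c k * hartley 1 k t)"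
    using f unfolding R_def trig_polys_def by (auto simp: fun_eq_iff)
  show ?thesis
  proof
    show "finite F" by fact
    show "\<bar>v t - (\<Sum>k\<in>F. c k * hartley \<omega> k t)\<bar> < e" for t
    proof -
      have "(\<Sum>k\<in>F. c k * hartley \<omega> k t) = f (cis (\<omega> * t))"
        unfolding F by (simp add: hartley_def mult.assoc)
      then show ?thesis
        using fe [of "cis (\<omega> * t)"] \<omega> continuous_on_sphere_Arg(2) [OF contg perg, of "\<omega> * t"]
        by (simp add: g_def)
    qed
  qed
qed

section \<open>Orthogonal families of square integrable functions\<close>

text \<open>Turns integrals over one period into plain integrals for a finite measure, for which
  square integrability implies integrability.\<close>

abbreviation lebesgue_upto :: "real \<Rightarrow> real measure" where
  "lebesgue_upto T \<equiv> restrict_space lborel {0..T}"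

lemma space_lebesgue_upto: "space (lebesgue_upto T) = {0..T}"
  by (simp add: space_restrict_space)

lemma finite_measure_lebesgue_upto: "finite_measure (lebesgue_upto T)"
  by (rule finite_measureI) (simp add: space_restrict_space emeasure_restrict_space emeasure_lborel_Icc_eq)

lemma measure_lebesgue_upto: "T \<ge> 0 \<Longrightarrow> measure (lebesgue_upto T) {0..T} = T"
  by (simp add: measure_restrict_space)

lemma integrable_lebesgue_upto_continuous:
  fixes f :: "real \<Rightarrow> 'a::euclidean_space"
  assumes "continuous_on {0..T} f"
  shows "integrable (lebesgue_upto T) f"
  using borel_integrable_compact [OF _ assms] by (simp add: integrable_restrict_space)

lemma borel_measurable_lebesgue_upto_continuous:
  fixes f :: "real \<Rightarrow> 'a::euclidean_space"
  assumes "continuous_on {0..T} f"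
  shows "f \<in> borel_measurable (lebesgue_upto T)"
  using integrable_lebesgue_upto_continuous [OF assms] by (rule borel_measurable_integrable)

lemma integral_lebesgue_upto_FTC:
  fixes F :: "real \<Rightarrow> real"
  assumes "T \<ge> 0" "\<And>t. (F has_real_derivative f t) (at t)" "continuous_on {0..T} f"
  shows "(\<integral>t. f t \<partial>lebesgue_upto T) = F T - F 0"
proof -
  have "(\<integral>t. indicator {0..T} t *\<^sub>R f t \<partial>lborel) = F T - F 0"
    using assms by (intro integral_FTC_Icc)
      (auto simp: has_real_derivative_iff_has_vector_derivative intro: has_vector_derivative_at_within)
  then show ?thesis
    by (simp add: integral_restrict_space)
qed

definition square_integrable :: "'a measure \<Rightarrow> ('a \<Rightarrow> real) \<Rightarrow> bool" where
  "square_integrable M f \<longleftrightarrow> f \<in> borel_measurable M \<and> integrable M (\<lambda>x. (f x)\<^sup>2)"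

lemma square_integrable_mult:
  assumes "square_integrable M f" "square_integrable M g"
  shows "integrable M (\<lambda>x. f x * g x)"
proof -
  have [measurable]: "f \<in> borel_measurable M" "g \<in> borel_measurable M"
    using assms by (auto simp: square_integrable_def)
  have "norm (f x * g x) \<le> norm ((f x)\<^sup>2 + (g x)\<^sup>2)" for x
  proof -
    have "2 * \<bar>f x * g x\<bar> \<le> (f x)\<^sup>2 + (g x)\<^sup>2"
      using sum_squares_bound [of "\<bar>f x\<bar>" "\<bar>g x\<bar>"] by (simp add: abs_mult)
    then show ?thesis
      by simp
  qed
  then have "AE x in M. norm (f x * g x) \<le> norm ((f x)\<^sup>2 + (g x)\<^sup>2)"
    by (rule AE_I2)
  moreover have "integrable M (\<lambda>x. (f x)\<^sup>2 + (g x)\<^sup>2)"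
    using assms by (auto simp: square_integrable_def)
  moreover have "(\<lambda>x. f x * g x) \<in> borel_measurable M"
    by measurable
  ultimately show ?thesis
    by (rule Bochner_Integration.integrable_bound [rotated 2])
qed

lemma square_integrable_add:
  assumes "square_integrable M f" "square_integrable M g"
  shows "square_integrable M (\<lambda>x. f x + g x)"
  unfolding square_integrable_def
proof
  show "(\<lambda>x. f x + g x) \<in> borel_measurable M"
    using assms by (auto simp: square_integrable_def)
  have "integrable M (\<lambda>x. (f x)\<^sup>2 + (g x)\<^sup>2 + 2 * (f x * g x))"
    using assms square_integrable_mult [OF assms]
    by (auto simp: square_integrable_def)
  then show "integrable M (\<lambda>x. (f x + g x)\<^sup>2)"
    by (simp add: power2_sum algebra_simps)
qed

lemma square_integrable_scale:
  "square_integrable M f \<Longrightarrow> square_integrable M (\<lambda>x. c * f x)"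
  by (auto simp: square_integrable_def power_mult_distrib)

lemma square_integrable_sum:
  "(\<And>k. k \<in> F \<Longrightarrow> square_integrable M (f k)) \<Longrightarrow> square_integrable M (\<lambda>x. \<Sum>k\<in>F. f k x)"
proof (induction F rule: infinite_finite_induct)
  case (insert k F)
  then show ?case by (simp add: square_integrable_add)
qed (auto simp: square_integrable_def)

lemma square_integrable_lebesgue_upto_continuous:
  "continuous_on {0..T} f \<Longrightarrow> square_integrable (lebesgue_upto T) f"
  unfolding square_integrable_def
  by (auto intro!: integrable_lebesgue_upto_continuous continuous_intros
      borel_measurable_lebesgue_upto_continuous)

text \<open>The family is not normalised: each member has squared norm \<open>T\<close>, as the
  Hartley functions do over one period. Fourier coefficients are therefore inner products divided by
  \<open>T\<close>, and Bessel's inequality carries a factor \<open>T\<close>.\<close>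

locale orthogonal_family =
  fixes M :: "'a measure" and e :: "'i \<Rightarrow> 'a \<Rightarrow> real" and T :: real
  assumes e: "\<And>k. square_integrable M (e k)"
    and ortho: "\<And>j k. (\<integral>x. e j x * e k x \<partial>M) = (if j = k then T else 0)"
    and T_pos: "T > 0"
begin

lemma square_integrable_lincomb: "square_integrable M (\<lambda>x. \<Sum>k\<in>F. c k * e k x)"
  by (intro square_integrable_sum square_integrable_scale e)

lemma integral_mult_lincomb:
  assumes "square_integrable M f"
  shows "(\<integral>x. f x * (\<Sum>k\<in>F. c k * e k x) \<partial>M) = (\<Sum>k\<in>F. c k * (\<integral>x. f x * e k x \<partial>M))"
proof -
  have "(\<integral>x. f x * (\<Sum>k\<in>F. c k * e k x) \<partial>M) = (\<integral>x. (\<Sum>k\<in>F. c k * (f x * e k x)) \<partial>M)"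
    by (simp add: sum_distrib_left mult_ac)
  also have "\<dots> = (\<Sum>k\<in>F. (\<integral>x. c k * (f x * e k x) \<partial>M))"
    using square_integrable_mult [OF assms e]
    by (intro Bochner_Integration.integral_sum) auto
  finally show ?thesis by simp
qed

lemma integral_lincomb_mult_basis:
  assumes "finite F"
  shows "(\<integral>x. (\<Sum>k\<in>F. c k * e k x) * e j x \<partial>M) = (if j \<in> F then T * c j else 0)"
proof -
  have "(\<integral>x. (\<Sum>k\<in>F. c k * e k x) * e j x \<partial>M) = (\<Sum>k\<in>F. c k * (\<integral>x. e j x * e k x \<partial>M))"
    using integral_mult_lincomb [OF e, where F = F and c = c] by (simp add: mult.commute)
  also have "\<dots> = (\<Sum>k\<in>F. if j = k then T * c k else 0)"
    by (intro sum.cong) (auto simp: ortho)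
  finally show ?thesis using assms by simp
qed

lemma integral_lincomb_mult_lincomb:
  assumes "finite F"
  shows "(\<integral>x. (\<Sum>k\<in>F. c k * e k x) * (\<Sum>k\<in>F. d k * e k x) \<partial>M) = T * (\<Sum>k\<in>F. c k * d k)"
proof -
  have "(\<integral>x. (\<Sum>k\<in>F. c k * e k x) * (\<Sum>k\<in>F. d k * e k x) \<partial>M)
      = (\<Sum>j\<in>F. d j * (\<integral>x. (\<Sum>k\<in>F. c k * e k x) * e j x \<partial>M))"
    by (rule integral_mult_lincomb [OF square_integrable_lincomb])
  also have "\<dots> = (\<Sum>j\<in>F. d j * (T * c j))"
    unfolding integral_lincomb_mult_basis [OF assms] by (intro sum.cong) auto
  finally show ?thesis by (simp add: sum_distrib_left mult.commute mult.left_commute)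
qed

lemma integral_square_diff_lincomb:
  assumes "square_integrable M f" "finite F"
  shows "(\<integral>x. (f x - (\<Sum>k\<in>F. c k * e k x))\<^sup>2 \<partial>M) =
    (\<integral>x. (f x)\<^sup>2 \<partial>M) - 2 * (\<Sum>k\<in>F. c k * (\<integral>x. f x * e k x \<partial>M)) + T * (\<Sum>k\<in>F. (c k)\<^sup>2)"
proof -
  let ?P = "\<lambda>x. \<Sum>k\<in>F. c k * e k x"
  have P: "square_integrable M ?P"
    by (rule square_integrable_lincomb)
  have "(\<integral>x. (f x - ?P x)\<^sup>2 \<partial>M) = (\<integral>x. (f x)\<^sup>2 - 2 * (f x * ?P x) + ?P x * ?P x \<partial>M)"
    by (intro Bochner_Integration.integral_cong refl) algebra
  also have "\<dots> = (\<integral>x. (f x)\<^sup>2 \<partial>M) - 2 * (\<integral>x. f x * ?P x \<partial>M) + (\<integral>x. ?P x * ?P x \<partial>M)"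
    using square_integrable_mult [OF assms(1) P] square_integrable_mult [OF P P] assms(1)
    by (simp add: square_integrable_def)
  finally show ?thesis
    by (simp add: integral_mult_lincomb [OF assms(1)] integral_lincomb_mult_lincomb [OF assms(2)]
        power2_eq_square)
qed

text \<open>The squared distance from \<open>f\<close> to its partial Fourier sum, with coefficients
  \<open>a k / T\<close>, is nonnegative.\<close>

lemma bessel_inequality:
  assumes "square_integrable M f" "finite F"
  shows "(\<Sum>k\<in>F. (\<integral>x. f x * e k x \<partial>M)\<^sup>2) \<le> T * (\<integral>x. (f x)\<^sup>2 \<partial>M)"
proof -
  define a where "a k = (\<integral>x. f x * e k x \<partial>M)" for k
  have "0 \<le> (\<integral>x. (f x - (\<Sum>k\<in>F. a k / T * e k x))\<^sup>2 \<partial>M)"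
    by simp
  also have "\<dots> = (\<integral>x. (f x)\<^sup>2 \<partial>M) - 2 * (\<Sum>k\<in>F. a k / T * a k) + T * (\<Sum>k\<in>F. (a k / T)\<^sup>2)"
    unfolding a_def by (rule integral_square_diff_lincomb [OF assms])
  also have "(\<Sum>k\<in>F. a k / T * a k) = (\<Sum>k\<in>F. (a k)\<^sup>2) / T"
    by (simp add: power2_eq_square sum_divide_distrib)
  also have "T * (\<Sum>k\<in>F. (a k / T)\<^sup>2) = (\<Sum>k\<in>F. (a k)\<^sup>2) / T"
    using T_pos by (simp add: power_divide sum_divide_distrib [symmetric] power2_eq_square)
  finally have "(\<Sum>k\<in>F. (a k)\<^sup>2) / T \<le> (\<integral>x. (f x)\<^sup>2 \<partial>M)"
    by linarith
  then show ?thesis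
    unfolding a_def pos_divide_le_eq [OF T_pos] by (simp only: mult.commute)
qed

text \<open>A converse of Bessel up to the error of an arbitrary approximant: passing from
  coefficients \<open>c k\<close> to Fourier coefficients lowers the error by a multiple of the sum
  of the squares of \<open>a k - T * c k\<close>.\<close>

lemma bessel_best_approximation:
  assumes "square_integrable M f" "finite F"
  shows "T * (\<integral>x. (f x)\<^sup>2 \<partial>M) \<le> (\<Sum>k\<in>F. (\<integral>x. f x * e k x \<partial>M)\<^sup>2)
      + T * (\<integral>x. (f x - (\<Sum>k\<in>F. c k * e k x))\<^sup>2 \<partial>M)"
proof -
  define a where "a k = (\<integral>x. f x * e k x \<partial>M)" for k
  have "(a k - T * c k)\<^sup>2 = (a k)\<^sup>2 - 2 * T * (c k * a k) + T\<^sup>2 * (c k)\<^sup>2" for k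
    by algebra
  then have "(\<Sum>k\<in>F. (a k - T * c k)\<^sup>2)
      = (\<Sum>k\<in>F. (a k)\<^sup>2) - 2 * T * (\<Sum>k\<in>F. c k * a k) + T\<^sup>2 * (\<Sum>k\<in>F. (c k)\<^sup>2)"
    unfolding sum_distrib_left by (simp only: sum.distrib sum_subtractf)
  then have "0 \<le> (\<Sum>k\<in>F. (a k)\<^sup>2) - 2 * T * (\<Sum>k\<in>F. c k * a k) + T\<^sup>2 * (\<Sum>k\<in>F. (c k)\<^sup>2)"
    using sum_nonneg [of F "\<lambda>k. (a k - T * c k)\<^sup>2"] by simp
  moreover have "T * (X - 2 * Y + T * Z) = T * X - 2 * T * Y + T\<^sup>2 * Z" for X Y Z
    by algebra
  ultimately show ?thesis
    unfolding integral_square_diff_lincomb [OF assms] a_def [symmetric] by simp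
qed

end

lemma integral_hartley:
  assumes "\<omega> > 0" "k \<noteq> 0"
  shows "(\<integral>t. hartley \<omega> k t \<partial>lebesgue_upto (2 * pi / \<omega>)) = 0"
proof -
  let ?T = "2 * pi / \<omega>"
  have der: "((\<lambda>t. - hartley \<omega> (- k) t / (of_int k * \<omega>)) has_real_derivative hartley \<omega> k t) (at t)" for t
    using assms by (auto intro!: derivative_eq_intros)
  have "(\<integral>t. hartley \<omega> k t \<partial>lebesgue_upto ?T)
      = - hartley \<omega> (- k) ?T / (of_int k * \<omega>) - - hartley \<omega> (- k) 0 / (of_int k * \<omega>)"
    using assms by (intro integral_lebesgue_upto_FTC der continuous_intros) auto
  also have "\<dots> = 0"
    using hartley_periodic [of \<omega> "- k" 0] assms by simp
  finally show ?thesis .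
qed

lemma orthogonal_family_hartley:
  assumes "\<omega> > 0"
  shows "orthogonal_family (lebesgue_upto (2 * pi / \<omega>)) (hartley \<omega>) (2 * pi / \<omega>)"
proof
  let ?T = "2 * pi / \<omega>"
  let ?M = "lebesgue_upto ?T"
  show "?T > 0" using assms by simp
  show "square_integrable ?M (hartley \<omega> k)" for k
    by (intro square_integrable_lebesgue_upto_continuous continuous_intros)
  have int [simp]: "integrable ?M (hartley \<omega> k)" for k
    by (intro integrable_lebesgue_upto_continuous continuous_intros)
  have val: "(\<integral>t. hartley \<omega> k t \<partial>?M) = (if k = 0 then ?T else 0)" for k
    using assms integral_hartley [OF assms] measure_lebesgue_upto [of ?T]
    by (auto simp: space_lebesgue_upto)
  show "(\<integral>x. hartley \<omega> j x * hartley \<omega> k x \<partial>?M) = (if j = k then ?T else 0)" for j k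
  proof -
    have "(\<integral>x. hartley \<omega> j x * hartley \<omega> k x \<partial>?M) =
        ((\<integral>x. hartley \<omega> (j - k) x \<partial>?M) + (\<integral>x. hartley \<omega> (k - j) x \<partial>?M)
          + (\<integral>x. hartley \<omega> (j + k) x \<partial>?M) - (\<integral>x. hartley \<omega> (- j - k) x \<partial>?M)) / 2"
      unfolding hartley_mult by simp
    also have "\<dots> = (if j = k then ?T else 0)"
      \<comment> \<open>The first two integrals vanish unless \<open>j = k\<close>. The last two
        cancel when \<open>j + k = 0\<close> and vanish otherwise.\<close>
      unfolding val by (cases "j = k") (auto simp: field_simps)
    finally show ?thesis .
  qed
qed

section \<open>Weak derivatives and Wirtinger's inequality\<close>

definition real_weak_deriv :: "real \<Rightarrow> (real \<Rightarrow> real) \<Rightarrow> (real \<Rightarrow> real) \<Rightarrow> bool" where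
  "real_weak_deriv T u w \<longleftrightarrow> square_integrable (lebesgue_upto T) w \<and>
     (\<forall>t\<in>{0..T}. u t = u 0 + (\<integral>s. indicator {0..t} s * w s \<partial>lebesgue_upto T))"

lemma square_integrable_imp_integrable:
  assumes "finite_measure M" "square_integrable M f"
  shows "integrable M f"
proof -
  interpret finite_measure M by fact
  have "square_integrable M (\<lambda>_. 1)"
    by (simp add: square_integrable_def)
  from square_integrable_mult [OF assms(2) this] show ?thesis
    by simp
qed

lemma real_weak_derivD:
  assumes "real_weak_deriv T u w"
  shows "square_integrable (lebesgue_upto T) w"
    and "t \<in> {0..T} \<Longrightarrow> u t = u 0 + (\<integral>s. indicator {0..t} s * w s \<partial>lebesgue_upto T)"
  using assms unfolding real_weak_deriv_def by blast+

lemma real_weak_deriv_integrable: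
  "real_weak_deriv T u w \<Longrightarrow> integrable (lebesgue_upto T) w"
  unfolding real_weak_deriv_def
  by (blast intro: square_integrable_imp_integrable finite_measure_lebesgue_upto)

lemma set_integral_lebesgue_upto:
  fixes w :: "real \<Rightarrow> 'a::euclidean_space"
  assumes "t \<le> T"
  shows "(LBINT s:{0..t}. w s) = (\<integral>s. indicator {0..t} s *\<^sub>R w s \<partial>lebesgue_upto T)"
proof -
  have "(\<integral>s. indicator {0..t} s *\<^sub>R w s \<partial>lebesgue_upto T)
      = (\<integral>s. indicator {0..T} s *\<^sub>R indicator {0..t} s *\<^sub>R w s \<partial>lborel)"
    by (simp add: integral_restrict_space)
  also have "\<dots> = (\<integral>s. indicator {0..t} s *\<^sub>R w s \<partial>lborel)"
    using assms by (intro Bochner_Integration.integral_cong refl) (auto simp: indicator_def)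
  finally show ?thesis
    by (simp add: set_lebesgue_integral_def)
qed

lemma integrable_vec_iff:
  fixes w :: "'a \<Rightarrow> real ^ 'n::finite"
  shows "integrable M w \<longleftrightarrow> (\<forall>i. integrable M (\<lambda>t. w t $ i))"
proof
  assume w: "integrable M w"
  show "\<forall>i. integrable M (\<lambda>t. w t $ i)"
    using integrable_bounded_linear [OF bounded_linear_vec_nth w] by blast
next
  assume "\<forall>i. integrable M (\<lambda>t. w t $ i)"
  then have "integrable M (\<lambda>t. \<Sum>i\<in>UNIV. w t $ i *\<^sub>R axis i (1::real))"
    by (intro Bochner_Integration.integrable_sum integrable_scaleR_left) auto
  moreover have "(\<Sum>i\<in>UNIV. w t $ i *\<^sub>R axis i (1::real)) = w t" for t
    using basis_expansion [of "w t"] by (simp add: scalar_mult_eq_scaleR)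
  ultimately show "integrable M w"
    by simp
qed

text \<open>Reduces the analysis to scalar functions: integrability of a vector function and of its
  squared norm together amount to square integrability of the components, and the integral commutes
  with coordinate projections.\<close>

lemma has_weak_deriv_iff:
  "has_weak_deriv T u w \<longleftrightarrow> (\<forall>i. real_weak_deriv T (\<lambda>t. u t $ i) (\<lambda>t. w t $ i))"
proof -
  let ?M = "lebesgue_upto T"
  have 1: "set_integrable lborel {0..T} f \<longleftrightarrow> integrable ?M f" for f :: "real \<Rightarrow> 'b::euclidean_space"
    by (simp add: set_integrable_def integrable_restrict_space)
  have norm2: "(norm (w t))\<^sup>2 = (w t $ 1)\<^sup>2 + (w t $ 2)\<^sup>2" for t
    by (simp add: norm_eq_sqrt_inner inner_vec_def sum_2 power2_eq_square)
  have sq: "(integrable ?M w \<and> integrable ?M (\<lambda>t. (norm (w t))\<^sup>2)) \<longleftrightarrow>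
      (\<forall>i. square_integrable ?M (\<lambda>t. w t $ i))"
  proof
    assume *: "integrable ?M w \<and> integrable ?M (\<lambda>t. (norm (w t))\<^sup>2)"
    show "\<forall>i. square_integrable ?M (\<lambda>t. w t $ i)"
    proof
      fix i :: 2
      have meas: "(\<lambda>t. w t $ i) \<in> borel_measurable ?M"
        using * integrable_vec_iff [of ?M w] by auto
      moreover have "integrable ?M (\<lambda>t. (w t $ i)\<^sup>2)"
      proof (rule Bochner_Integration.integrable_bound)
        show "integrable ?M (\<lambda>t. (norm (w t))\<^sup>2)" using * by simp
        show "(\<lambda>t. (w t $ i)\<^sup>2) \<in> borel_measurable ?M" using meas by simp
        show "AE t in ?M. norm ((w t $ i)\<^sup>2) \<le> norm ((norm (w t))\<^sup>2)"
          using component_le_norm_cart by (intro AE_I2) (simp add: abs_le_square_iff [symmetric])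
      qed
      ultimately show "square_integrable ?M (\<lambda>t. w t $ i)"
        by (simp add: square_integrable_def)
    qed
  next
    assume *: "\<forall>i. square_integrable ?M (\<lambda>t. w t $ i)"
    then have "integrable ?M w"
      unfolding integrable_vec_iff
      by (blast intro: square_integrable_imp_integrable finite_measure_lebesgue_upto)
    moreover have "integrable ?M (\<lambda>t. (norm (w t))\<^sup>2)"
      unfolding norm2 using * by (auto simp: square_integrable_def)
    ultimately show "integrable ?M w \<and> integrable ?M (\<lambda>t. (norm (w t))\<^sup>2)" ..
  qed
  have int: "(LBINT s:{0..t}. w s) $ i = (\<integral>s. indicator {0..t} s * w s $ i \<partial>?M)"
    if "integrable ?M w" "t \<in> {0..T}" for t i
  proof -
    have "integrable ?M (\<lambda>s. indicator {0..t} s *\<^sub>R w s)"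
      using that by (intro integrable_mult_indicator) (auto simp: sets_restrict_space)
    from integral_bounded_linear [OF bounded_linear_vec_nth this, of i]
    show ?thesis
      using that set_integral_lebesgue_upto [of t T w] by simp
  qed
  have eq: "u t = u 0 + (LBINT s:{0..t}. w s) \<longleftrightarrow>
      (\<forall>i. u t $ i = u 0 $ i + (\<integral>s. indicator {0..t} s * w s $ i \<partial>?M))"
    if "integrable ?M w" "t \<in> {0..T}" for t
    unfolding vec_eq_iff vector_add_component int [OF that] ..
  have "has_weak_deriv T u w \<longleftrightarrow> (integrable ?M w \<and> integrable ?M (\<lambda>t. (norm (w t))\<^sup>2)) \<and>
      (\<forall>t\<in>{0..T}. u t = u 0 + (LBINT s:{0..t}. w s))"
    unfolding has_weak_deriv_def 1 by (rule conj_assoc [symmetric])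
  also have "\<dots> \<longleftrightarrow> (integrable ?M w \<and> integrable ?M (\<lambda>t. (norm (w t))\<^sup>2)) \<and>
      (\<forall>t\<in>{0..T}. \<forall>i. u t $ i = u 0 $ i + (\<integral>s. indicator {0..t} s * w s $ i \<partial>?M))"
    using eq by blast
  also have "\<dots> \<longleftrightarrow> (\<forall>i. real_weak_deriv T (\<lambda>t. u t $ i) (\<lambda>t. w t $ i))"
    unfolding sq real_weak_deriv_def by blast
  finally show ?thesis .
qed

text \<open>As \<open>u\<close> is only an indefinite integral of \<open>w\<close>, the formula
  comes from Fubini on the triangle \<open>t \<le> s\<close> with integrand
  \<open>w t * \<phi>' s\<close>. Integrating over \<open>t\<close> first gives
  \<open>(u s - u 0) * \<phi>' s\<close>, integrating over \<open>s\<close> first gives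
  \<open>w t * (\<phi> T - \<phi> t)\<close>.\<close>

lemma real_weak_deriv_by_parts:
  assumes u: "real_weak_deriv T u w" "continuous_on {0..T} u" and T: "T \<ge> 0"
    and der: "\<And>t. (\<phi> has_real_derivative \<phi>' t) (at t)" and cont: "continuous_on UNIV \<phi>'"
  shows "(\<integral>t. w t * \<phi> t \<partial>lebesgue_upto T)
     = u T * \<phi> T - u 0 * \<phi> 0 - (\<integral>t. u t * \<phi>' t \<partial>lebesgue_upto T)"
proof -
  let ?M = "lebesgue_upto T"
  interpret M: finite_measure ?M by (rule finite_measure_lebesgue_upto)
  interpret pair_sigma_finite ?M ?M ..
  have w: "integrable ?M w" by (rule real_weak_deriv_integrable [OF u(1)])
  have cont\<phi>: "continuous_on S \<phi>" for S
    using der by (meson DERIV_isCont continuous_at_imp_continuous_on)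
  have cont\<phi>': "continuous_on S \<phi>'" for S
    using cont by (rule continuous_on_subset) simp
  have \<phi>': "integrable ?M \<phi>'"
    by (rule integrable_lebesgue_upto_continuous [OF cont\<phi>'])
  have [measurable]: "w \<in> borel_measurable ?M" "\<phi>' \<in> borel_measurable ?M"
    using w \<phi>' by auto
  define K where "K = (\<lambda>t s. indicator {p. fst p \<le> snd p} (t, s) * (w t * \<phi>' s))"
  have idM [measurable]: "(\<lambda>x. x) \<in> borel_measurable ?M"
    by (rule borel_measurable_lebesgue_upto_continuous) (rule continuous_on_id)
  have set: "{p \<in> space (?M \<Otimes>\<^sub>M ?M). fst p \<le> snd p} \<in> sets (?M \<Otimes>\<^sub>M ?M)"
    by measurable
  have "integrable (?M \<Otimes>\<^sub>M ?M) (\<lambda>p. w (fst p) * \<phi>' (snd p))"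
  proof (rule Fubini_integrable)
    show "integrable ?M (\<lambda>x. \<integral>y. norm (w (fst (x, y)) * \<phi>' (snd (x, y))) \<partial>?M)"
      using w \<phi>' by (simp add: abs_mult)
    show "AE x in ?M. integrable ?M (\<lambda>y. w (fst (x, y)) * \<phi>' (snd (x, y)))"
      using \<phi>' by simp
  qed measurable
  from integrable_mult_indicator [OF set this]
  have "integrable (?M \<Otimes>\<^sub>M ?M) (\<lambda>p. indicator {p \<in> space (?M \<Otimes>\<^sub>M ?M). fst p \<le> snd p} p *\<^sub>R
      (w (fst p) * \<phi>' (snd p)))" .
  also have "?this \<longleftrightarrow> integrable (?M \<Otimes>\<^sub>M ?M) (case_prod K)"
  proof (rule Bochner_Integration.integrable_cong [OF refl])
    fix p assume "p \<in> space (?M \<Otimes>\<^sub>M ?M)"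
    then show "indicator {p \<in> space (?M \<Otimes>\<^sub>M ?M). fst p \<le> snd p} p *\<^sub>R (w (fst p) * \<phi>' (snd p))
        = case_prod K p"
      by (cases "fst p \<le> snd p") (simp_all add: K_def case_prod_unfold)
  qed
  finally have "integrable (?M \<Otimes>\<^sub>M ?M) (case_prod K)" .
  then have fub: "(\<integral>s. (\<integral>t. K t s \<partial>?M) \<partial>?M) = (\<integral>t. (\<integral>s. K t s \<partial>?M) \<partial>?M)"
    by (rule Fubini_integral)
  have inner_t: "(\<integral>t. K t s \<partial>?M) = (u s - u 0) * \<phi>' s" if "s \<in> {0..T}" for s
  proof -
    have "(\<integral>t. K t s \<partial>?M) = (\<integral>t. indicator {0..s} t * w t * \<phi>' s \<partial>?M)"
      by (intro Bochner_Integration.integral_cong refl)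
        (auto simp: K_def indicator_def space_lebesgue_upto)
    also have "\<dots> = (\<integral>t. indicator {0..s} t * w t \<partial>?M) * \<phi>' s"
      by simp
    also have "(\<integral>t. indicator {0..s} t * w t \<partial>?M) = u s - u 0"
      using real_weak_derivD(2) [OF u(1) that] by linarith
    finally show ?thesis .
  qed
  have inner_s: "(\<integral>s. K t s \<partial>?M) = w t * (\<phi> T - \<phi> t)" if "t \<in> {0..T}" for t
  proof -
    have "(\<integral>s. K t s \<partial>?M) = (\<integral>s. w t * (indicator {t..T} s * \<phi>' s) \<partial>?M)"
      using that by (intro Bochner_Integration.integral_cong refl)
        (auto simp: K_def indicator_def space_lebesgue_upto)
    also have "\<dots> = w t * (\<integral>s. indicator {t..T} s * \<phi>' s \<partial>?M)"
      by simp
    also have "(\<integral>s. indicator {t..T} s * \<phi>' s \<partial>?M) =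
        (\<integral>s. indicator {0..T} s *\<^sub>R (indicator {t..T} s * \<phi>' s) \<partial>lborel)"
      by (simp add: integral_restrict_space)
    also have "\<dots> = (\<integral>s. indicator {t..T} s *\<^sub>R \<phi>' s \<partial>lborel)"
      using that by (intro Bochner_Integration.integral_cong refl) (auto simp: indicator_def)
    also have "\<dots> = \<phi> T - \<phi> t"
      using that der cont\<phi>'
      by (intro integral_FTC_Icc)
        (auto simp: has_real_derivative_iff_has_vector_derivative intro: has_vector_derivative_at_within)
    finally show ?thesis .
  qed
  have iu: "integrable ?M (\<lambda>t. u t * \<phi>' t)"
    by (intro integrable_lebesgue_upto_continuous continuous_intros u cont\<phi>')
  have i\<phi>: "integrable ?M (\<lambda>t. w t * \<phi> t)"
    by (intro square_integrable_mult square_integrable_lebesgue_upto_continuous cont\<phi>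
        real_weak_derivD(1) [OF u(1)])
  have uT: "u T = u 0 + (\<integral>s. w s \<partial>?M)"
  proof -
    have "(\<integral>s. indicator {0..T} s * w s \<partial>?M) = (\<integral>s. w s \<partial>?M)"
      by (intro Bochner_Integration.integral_cong) (auto simp: space_lebesgue_upto)
    then show ?thesis
      using real_weak_derivD(2) [OF u(1), of T] T by simp
  qed
  have I\<phi>': "(\<integral>t. \<phi>' t \<partial>?M) = \<phi> T - \<phi> 0"
    by (intro integral_lebesgue_upto_FTC T der cont\<phi>')
  have "(\<integral>s. (\<integral>t. K t s \<partial>?M) \<partial>?M) = (\<integral>s. u s * \<phi>' s - u 0 * \<phi>' s \<partial>?M)"
    using inner_t by (intro Bochner_Integration.integral_cong)
      (auto simp: space_lebesgue_upto left_diff_distrib)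
  also have "\<dots> = (\<integral>s. u s * \<phi>' s \<partial>?M) - u 0 * (\<phi> T - \<phi> 0)"
    using iu \<phi>' by (simp add: I\<phi>')
  finally have L: "(\<integral>s. (\<integral>t. K t s \<partial>?M) \<partial>?M) = (\<integral>s. u s * \<phi>' s \<partial>?M) - u 0 * (\<phi> T - \<phi> 0)" .
  have "(\<integral>t. (\<integral>s. K t s \<partial>?M) \<partial>?M) = (\<integral>t. w t * \<phi> T - w t * \<phi> t \<partial>?M)"
    using inner_s by (intro Bochner_Integration.integral_cong)
      (auto simp: space_lebesgue_upto right_diff_distrib)
  also have "\<dots> = (u T - u 0) * \<phi> T - (\<integral>t. w t * \<phi> t \<partial>?M)"
    using w i\<phi> by (simp add: uT)
  finally show ?thesis
    using fub L by (simp add: algebra_simps)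
qed

lemma real_weak_deriv_smooth:
  assumes der: "\<And>t. (u has_real_derivative w t) (at t)" and cont: "continuous_on UNIV w"
  shows "real_weak_deriv T u w"
proof -
  have contw: "continuous_on S w" for S
    using cont by (rule continuous_on_subset) simp
  have "(\<integral>s. indicator {0..t} s * w s \<partial>lebesgue_upto T) = u t - u 0" if "t \<in> {0..T}" for t
  proof -
    have "(\<integral>s. indicator {0..t} s * w s \<partial>lebesgue_upto T) = (LBINT s:{0..t}. w s)"
      using set_integral_lebesgue_upto [of t T w] that by simp
    also have "\<dots> = (\<integral>s. indicator {0..t} s *\<^sub>R w s \<partial>lborel)"
      by (simp add: set_lebesgue_integral_def)
    also have "\<dots> = u t - u 0"
      using that der contw
      by (intro integral_FTC_Icc)
        (auto simp: has_real_derivative_iff_has_vector_derivative intro: has_vector_derivative_at_within)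
    finally show ?thesis .
  qed
  then show ?thesis
    unfolding real_weak_deriv_def by (simp add: square_integrable_lebesgue_upto_continuous contw)
qed

text \<open>The half-lines are closed under intersection and generate the Borel sets, so by Dynkin's
  argument \<open>d\<close> integrates to 0 over every Borel set. The total integral enters at
  complements.\<close>

lemma AE_eq_0_if_integrals_atMost_eq_0:
  fixes d :: "real \<Rightarrow> real"
  assumes d: "integrable lborel d" and d0: "\<And>t. (\<integral>s. indicator {..t} s * d s \<partial>lborel) = 0"
    and d1: "(\<integral>s. d s \<partial>lborel) = 0"
  shows "AE s in lborel. d s = 0"
proof (rule sigma_finite_measure.density_zero [OF sigma_finite_lborel d])
  have si: "set_integrable lborel A d" if "A \<in> sets borel" for A
    using that d unfolding set_integrable_def by (intro integrable_mult_indicator) auto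
  fix A :: "real set"
  assume "A \<in> sets lborel"
  then have A: "A \<in> sigma_sets UNIV (range (\<lambda>a. {..a::real}))"
    by (simp add: borel_eq_atMost)
  have meas: "B \<in> sets borel" if "B \<in> sigma_sets UNIV (range (\<lambda>a. {..a::real}))" for B
    using that by (simp add: borel_eq_atMost)
  have "Int_stable (range (\<lambda>a. {..a::real}))"
    by (auto simp: Int_stable_def)
  moreover have "range (\<lambda>a. {..a::real}) \<subseteq> Pow UNIV"
    by simp
  ultimately show "set_lebesgue_integral lborel A d = 0"
    using A
  proof (induction A rule: sigma_sets_induct_disjoint)
    case (basic A)
    then show ?case
      using d0 by (auto simp: set_lebesgue_integral_def)
  next
    case (compl A)
    have "indicator (UNIV - A) s *\<^sub>R d s = d s - indicator A s *\<^sub>R d s" for s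
      by (auto simp: indicator_def)
    then show ?case
      using compl d d1 si [OF meas [OF compl(1)]]
      by (simp add: set_lebesgue_integral_def set_integrable_def)
  next
    case (union A)
    have "set_lebesgue_integral lborel (\<Union>i. A i) d = (\<Sum>i. set_lebesgue_integral lborel (A i) d)"
    proof (rule lebesgue_integral_countable_add)
      show "A i \<in> sets lborel" for i
        using union(2) meas by auto
      then show "set_integrable lborel (\<Union>i. A i) d"
        by (intro si sets.countable_UN) auto
      show "A i \<inter> A j = {}" if "i \<noteq> j" for i j
        using union(1) that by (auto simp: disjoint_family_on_def)
    qed
    then show ?case
      using union(3) by simp
  qed (auto simp: set_lebesgue_integral_def)
qed

text \<open>Both candidates have the same integral over every \<open>{0..t}\<close>, so their
  difference, extended by 0 to the line, integrates to 0 over all half-lines. For negative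
  \<open>T\<close> the measure space is empty.\<close>

lemma real_weak_deriv_unique:
  assumes w: "real_weak_deriv T u w" and w': "real_weak_deriv T u w'"
  shows "AE t in lebesgue_upto T. w t = w' t"
proof (cases "T \<ge> 0")
  case True
  let ?M = "lebesgue_upto T"
  define d where "d s = indicator {0..T} s * (w s - w' s)" for s
  note int = real_weak_deriv_integrable [OF w] real_weak_deriv_integrable [OF w']
  have dM: "integrable ?M (\<lambda>s. w s - w' s)"
    using int by simp
  then have d: "integrable lborel d"
    by (simp add: integrable_restrict_space d_def [abs_def])
  have ii: "integrable ?M (\<lambda>s. indicator {0..t} s * f s)" if "integrable ?M f" "t \<le> T"
    for t and f :: "real \<Rightarrow> real"
    using integrable_mult_indicator [of "{0..t}" ?M f] that
    by (auto simp: sets_restrict_space_iff)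
  have d0: "(\<integral>s. indicator {0..t} s * d s \<partial>lborel) = 0" if t: "t \<in> {0..T}" for t
  proof -
    have "(\<integral>s. indicator {0..t} s * d s \<partial>lborel)
        = (\<integral>s. indicator {0..T} s *\<^sub>R (indicator {0..t} s * w s - indicator {0..t} s * w' s) \<partial>lborel)"
      by (intro Bochner_Integration.integral_cong refl) (auto simp: d_def indicator_def)
    also have "\<dots> = (\<integral>s. indicator {0..t} s * w s - indicator {0..t} s * w' s \<partial>?M)"
      by (simp add: integral_restrict_space)
    also have "\<dots> = (\<integral>s. indicator {0..t} s * w s \<partial>?M) - (\<integral>s. indicator {0..t} s * w' s \<partial>?M)"
      using ii int t by (intro Bochner_Integration.integral_diff) auto
    finally show ?thesis
      using real_weak_derivD(2) [OF w t] real_weak_derivD(2) [OF w' t] by linarith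
  qed
  have "AE s in lborel. d s = 0"
  proof (rule AE_eq_0_if_integrals_atMost_eq_0 [OF d])
    show "(\<integral>s. indicator {..t} s * d s \<partial>lborel) = 0" for t
    proof (cases "t < 0")
      case True
      then have "(\<lambda>s. indicator {..t} s * d s) = (\<lambda>s. 0)"
        by (auto simp: d_def indicator_def)
      then show ?thesis by (simp only: Bochner_Integration.integral_zero)
    next
      case False
      have "(\<integral>s. indicator {..t} s * d s \<partial>lborel) = (\<integral>s. indicator {0..min t T} s * d s \<partial>lborel)"
        by (intro Bochner_Integration.integral_cong refl) (auto simp: d_def indicator_def)
      then show ?thesis
        using False \<open>T \<ge> 0\<close> d0 [of "min t T"] by simp
    qed
    have "(\<integral>s. d s \<partial>lborel) = (\<integral>s. indicator {0..T} s * d s \<partial>lborel)"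
      by (intro Bochner_Integration.integral_cong refl) (auto simp: d_def indicator_def)
    then show "(\<integral>s. d s \<partial>lborel) = 0"
      using \<open>T \<ge> 0\<close> d0 [of T] by simp
  qed
  then show ?thesis
    by (auto simp: AE_restrict_space_iff d_def elim!: eventually_mono)
qed (auto intro!: AE_I2 simp: space_lebesgue_upto)

text \<open>Comparing Hartley coefficients: those of \<open>w\<close> are \<open>k\<omega>\<close> times those of \<open>v\<close>, with \<open>k\<close>
  and \<open>-k\<close> exchanged.\<close>

theorem wirtinger_inequality:
  fixes n :: nat
  assumes \<omega>: "\<omega> > 0" and T: "T = 2 * pi / \<omega>"
    and cont: "continuous_on UNIV v" and per: "\<And>t. v (t + T) = v t"
    and w: "real_weak_deriv T v w"
    and vanish: "\<And>k. k \<noteq> 0 \<Longrightarrow> \<bar>k\<bar> < int n \<Longrightarrow> (\<integral>t. v t * hartley \<omega> k t \<partial>lebesgue_upto T) = 0"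
  shows "(real n * \<omega>)\<^sup>2 *
      (T * (\<integral>t. (v t)\<^sup>2 \<partial>lebesgue_upto T) - (\<integral>t. v t \<partial>lebesgue_upto T)\<^sup>2)
    \<le> T * (\<integral>t. (w t)\<^sup>2 \<partial>lebesgue_upto T)"
proof (rule field_le_epsilon)
  fix \<epsilon> :: real
  assume \<epsilon>: "\<epsilon> > 0"
  let ?M = "lebesgue_upto T"
  have Tpos: "T > 0" using \<omega> T by simp
  interpret orthogonal_family ?M "hartley \<omega>" T
    unfolding T by (rule orthogonal_family_hartley [OF \<omega>])
  have contv: "continuous_on S v" for S
    using cont by (rule continuous_on_subset) simp
  define a where "a k = (\<integral>t. v t * hartley \<omega> k t \<partial>?M)" for k
  define b where "b k = (\<integral>t. w t * hartley \<omega> k t \<partial>?M)" for k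
  have b: "b k = - (of_int k * \<omega> * a (- k))" for k
  proof -
    have "b k = v T * hartley \<omega> k T - v 0 * hartley \<omega> k 0
        - (\<integral>t. v t * (of_int k * \<omega> * hartley \<omega> (- k) t) \<partial>?M)"
      unfolding b_def using Tpos
      by (intro real_weak_deriv_by_parts [OF w contv] derivative_intros continuous_intros) auto
    also have "v T * hartley \<omega> k T = v 0 * hartley \<omega> k 0"
      using per [of 0] hartley_periodic [of \<omega> k 0] \<omega> by (simp add: T)
    also have "(\<integral>t. v t * (of_int k * \<omega> * hartley \<omega> (- k) t) \<partial>?M)
        = (\<integral>t. of_int k * \<omega> * (v t * hartley \<omega> (- k) t) \<partial>?M)"
      by (simp only: mult_ac)
    also have "\<dots> = of_int k * \<omega> * a (- k)"
      unfolding a_def by (rule Bochner_Integration.integral_mult_right_zero)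
    finally show ?thesis by simp
  qed
  \<comment> \<open>A uniform error \<open>e\<close> costs at most \<open>T * e^2\<close> in the
    square integral, and this is later multiplied by \<open>T\<close> and by
    \<open>(real n * \<omega>)^2\<close>; the choice keeps the product below
    \<open>\<epsilon>\<close>. The summand 1 covers \<open>n = 0\<close>.\<close>
  define e where "e = sqrt (\<epsilon> / ((real n * \<omega>)\<^sup>2 * T\<^sup>2 + 1))"
  have pos: "(real n * \<omega>)\<^sup>2 * T\<^sup>2 + 1 > 0"
    by (intro add_nonneg_pos mult_nonneg_nonneg) auto
  then have e: "e > 0" "e\<^sup>2 = \<epsilon> / ((real n * \<omega>)\<^sup>2 * T\<^sup>2 + 1)"
    using \<epsilon> by (auto simp: e_def)
  have e\<epsilon>: "(real n * \<omega>)\<^sup>2 * (T * (T * e\<^sup>2)) \<le> \<epsilon>"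
  proof -
    have "(real n * \<omega>)\<^sup>2 * T\<^sup>2 * e\<^sup>2 \<le> ((real n * \<omega>)\<^sup>2 * T\<^sup>2 + 1) * e\<^sup>2"
      by (intro mult_right_mono) auto
    also have "\<dots> = \<epsilon>"
      using pos e by simp
    finally show ?thesis
      by (simp add: power2_eq_square mult_ac)
  qed
  obtain F c where F: "finite F" "\<And>t. \<bar>v t - (\<Sum>k\<in>F. c k * hartley \<omega> k t)\<bar> < e"
    using trig_poly_approximation [of \<omega> v e] \<omega> cont per e(1) T by auto
  \<comment> \<open>Closed under negation because differentiation exchanges the orders
    \<open>k\<close> and \<open>- k\<close>; containing 0 so that the mean can be split off.\<close>
  define G where "G = insert 0 (F \<union> uminus ` F)"
  have G: "finite G" "F \<subseteq> G" "0 \<in> G" "uminus ` G = G"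
    using F(1) by (auto simp: G_def image_Un image_image)
  define c' where "c' k = (if k \<in> F then c k else 0)" for k
  have c': "(\<Sum>k\<in>G. c' k * hartley \<omega> k t) = (\<Sum>k\<in>F. c k * hartley \<omega> k t)" for t
    by (rule sum.mono_neutral_cong_right) (use G in \<open>auto simp: c'_def\<close>)
  have sqv: "square_integrable ?M v"
    by (rule square_integrable_lebesgue_upto_continuous [OF contv])
  have "(\<integral>t. (v t - (\<Sum>k\<in>G. c' k * hartley \<omega> k t))\<^sup>2 \<partial>?M) \<le> (\<integral>t. e\<^sup>2 \<partial>?M)"
  proof (rule integral_mono)
    show "integrable ?M (\<lambda>t. (v t - (\<Sum>k\<in>G. c' k * hartley \<omega> k t))\<^sup>2)"
      by (intro integrable_lebesgue_upto_continuous continuous_intros contv)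
    show "integrable ?M (\<lambda>t. e\<^sup>2)"
      by (intro integrable_lebesgue_upto_continuous continuous_intros)
    show "(v t - (\<Sum>k\<in>G. c' k * hartley \<omega> k t))\<^sup>2 \<le> e\<^sup>2" for t
      unfolding c' using F(2) [of t] by (intro abs_le_square_iff [THEN iffD1]) simp
  qed
  also have "\<dots> = T * e\<^sup>2"
    using Tpos by (simp add: space_lebesgue_upto measure_lebesgue_upto)
  finally have err: "(\<integral>t. (v t - (\<Sum>k\<in>G. c' k * hartley \<omega> k t))\<^sup>2 \<partial>?M) \<le> T * e\<^sup>2" .
  have "T * (\<integral>t. (v t)\<^sup>2 \<partial>?M) \<le> (\<Sum>k\<in>G. (a k)\<^sup>2)
      + T * (\<integral>t. (v t - (\<Sum>k\<in>G. c' k * hartley \<omega> k t))\<^sup>2 \<partial>?M)"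
    unfolding a_def by (rule bessel_best_approximation [OF sqv G(1)])
  also have "\<dots> \<le> (\<Sum>k\<in>G. (a k)\<^sup>2) + T * (T * e\<^sup>2)"
    using err Tpos by simp
  also have "(\<Sum>k\<in>G. (a k)\<^sup>2) = (a 0)\<^sup>2 + (\<Sum>k\<in>G - {0}. (a k)\<^sup>2)"
    by (rule sum.remove) (use G in auto)
  finally have 1: "T * (\<integral>t. (v t)\<^sup>2 \<partial>?M) - (a 0)\<^sup>2 \<le> (\<Sum>k\<in>G - {0}. (a k)\<^sup>2) + T * (T * e\<^sup>2)"
    by simp
  have "(real n * \<omega>)\<^sup>2 * (\<Sum>k\<in>G - {0}. (a k)\<^sup>2) \<le> (\<Sum>k\<in>G - {0}. (of_int k * \<omega>)\<^sup>2 * (a k)\<^sup>2)"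
    unfolding sum_distrib_left
  proof (rule sum_mono)
    fix k assume k: "k \<in> G - {0}"
    show "(real n * \<omega>)\<^sup>2 * (a k)\<^sup>2 \<le> (of_int k * \<omega>)\<^sup>2 * (a k)\<^sup>2"
    proof (cases "\<bar>k\<bar> < int n")
      case True
      then have "a k = 0"
        using vanish k by (simp add: a_def)
      then show ?thesis by simp
    next
      case False
      then have "real n \<le> \<bar>real_of_int k\<bar>"
        by linarith
      then have "(real n)\<^sup>2 \<le> (real_of_int k)\<^sup>2"
        by (metis abs_le_square_iff abs_of_nat)
      then show ?thesis
        by (auto simp: power_mult_distrib intro!: mult_right_mono)
    qed
  qed
  also have "\<dots> \<le> (\<Sum>k\<in>G. (of_int k * \<omega>)\<^sup>2 * (a k)\<^sup>2)"
    by (rule sum_mono2) (use G in auto)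
  also have "\<dots> = (\<Sum>k\<in>uminus ` G. (of_int k * \<omega>)\<^sup>2 * (a k)\<^sup>2)"
    by (simp only: G(4))
  also have "\<dots> = (\<Sum>k\<in>G. (b k)\<^sup>2)"
    by (subst sum.reindex) (auto simp: b power_mult_distrib)
  also have "\<dots> \<le> T * (\<integral>t. (w t)\<^sup>2 \<partial>?M)"
    unfolding b_def by (rule bessel_inequality [OF real_weak_derivD(1) [OF w] G(1)])
  finally have 2: "(real n * \<omega>)\<^sup>2 * (\<Sum>k\<in>G - {0}. (a k)\<^sup>2) \<le> T * (\<integral>t. (w t)\<^sup>2 \<partial>?M)" .
  have "(real n * \<omega>)\<^sup>2 * (T * (\<integral>t. (v t)\<^sup>2 \<partial>?M) - (a 0)\<^sup>2)
      \<le> (real n * \<omega>)\<^sup>2 * ((\<Sum>k\<in>G - {0}. (a k)\<^sup>2) + T * (T * e\<^sup>2))"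
    using 1 by (intro mult_left_mono) auto
  also have "\<dots> = (real n * \<omega>)\<^sup>2 * (\<Sum>k\<in>G - {0}. (a k)\<^sup>2) + (real n * \<omega>)\<^sup>2 * (T * (T * e\<^sup>2))"
    by (rule distrib_left)
  also have "\<dots> \<le> T * (\<integral>t. (w t)\<^sup>2 \<partial>?M) + \<epsilon>"
    using 2 e\<epsilon> by linarith
  finally show "(real n * \<omega>)\<^sup>2 * (T * (\<integral>t. (v t)\<^sup>2 \<partial>?M) - (\<integral>t. v t \<partial>?M)\<^sup>2)
      \<le> T * (\<integral>t. (w t)\<^sup>2 \<partial>?M) + \<epsilon>"
    by (simp add: a_def)
qed

section \<open>Constant-coefficient index forms\<close>

text \<open>If \<open>f v0\<close> is nonzero, subtracting a multiple of \<open>v0\<close> moves any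
  vector of \<open>V\<close> into the kernel, so a basis of the kernel and \<open>v0\<close>
  together span \<open>V\<close>. The space of loops is infinite-dimensional; the finite set
  \<open>B\<close> makes the dimensions meaningful.\<close>

lemma dim_le_Suc_dim_kernel:
  fixes V :: "'a::real_vector set" and f :: "'a \<Rightarrow> real"
  assumes V: "subspace V" "finite B" "V \<subseteq> span B" and f: "linear f"
  shows "dim V \<le> Suc (dim {v \<in> V. f v = 0})"
proof (cases "\<forall>v\<in>V. f v = 0")
  case True
  then have "{v \<in> V. f v = 0} = V" by auto
  then show ?thesis by simp
next
  case False
  then obtain v0 where v0: "v0 \<in> V" "f v0 \<noteq> 0" by blast
  let ?K = "{v \<in> V. f v = 0}"
  obtain C where C: "C \<subseteq> ?K" "independent C" "?K \<subseteq> span C" "card C = dim ?K"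
    by (rule basis_exists)
  have finC: "finite C"
    using independent_span_bound [OF V(2) C(2)] C(1) V(3) by blast
  have "V \<subseteq> span (insert v0 C)"
  proof
    fix v assume v: "v \<in> V"
    have "v - (f v / f v0) *\<^sub>R v0 \<in> ?K"
      using v v0 V(1) f by (auto simp: subspace_diff subspace_scale linear_diff linear_scale)
    then have "v - (f v / f v0) *\<^sub>R v0 \<in> span C"
      using C(3) by blast
    then show "v \<in> span (insert v0 C)"
      unfolding span_insert by blast
  qed
  then have "dim V \<le> card (insert v0 C)"
    using finC by (intro dim_le_card) auto
  then show ?thesis
    using card_insert_le_m1 [of "Suc (card C)" C v0] C(4) finC by (simp add: card_insert_if split: if_splits)
qed

text \<open>Each functional lowers the dimension by at most one.\<close>

lemma exists_nonzero_in_common_kernel: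
  fixes V :: "'a::real_vector set" and f :: "'i \<Rightarrow> 'a \<Rightarrow> real"
  assumes "finite J" "subspace V" "finite B" "V \<subseteq> span B" "\<And>j. j \<in> J \<Longrightarrow> linear (f j)"
    and "card J < dim V"
  shows "\<exists>v\<in>V. v \<noteq> 0 \<and> (\<forall>j\<in>J. f j v = 0)"
  using assms
proof (induction J arbitrary: V rule: finite_induct)
  case empty
  have "\<not> V \<subseteq> {0}"
    using dim_le_card [of V "{}"] empty by auto
  then show ?case by auto
next
  case (insert j J)
  let ?K = "{v \<in> V. f j v = 0}"
  have lin: "linear (f j)" using insert.prems by blast
  have "subspace ?K"
    using insert.prems(1) lin
    by (auto simp: subspace_def linear_add linear_scale linear_0)
  moreover have "card J < dim ?K"
    using dim_le_Suc_dim_kernel [OF insert.prems(1-3) lin] insert by simp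
  ultimately have "\<exists>v\<in>?K. v \<noteq> 0 \<and> (\<forall>j\<in>J. f j v = 0)"
    using insert.prems by (intro insert.IH) auto
  then show ?case by auto
qed

lemma has_weak_deriv_weak_deriv:
  assumes "u \<in> sobolev_loops T"
  shows "has_weak_deriv T (apply_bcontfun u) (weak_deriv T (apply_bcontfun u))"
proof -
  obtain w where "has_weak_deriv T (apply_bcontfun u) w"
    using assms unfolding sobolev_loops_def by blast
  then show ?thesis
    unfolding weak_deriv_def by (rule someI [of "has_weak_deriv T (apply_bcontfun u)"])
qed

text \<open>A quadratic functional with constant coefficients whose only coupling is between the first
  component and the velocity of the second one. Completing the square in that velocity, the
  harmonic of order \<open>k \<noteq> 0\<close> in the first component is weighted by \<open>mode k\<close>; the mean is
  weighted by \<open>c\<close>, because a mean cannot be absorbed by the derivative of a periodic function.\<close>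

locale coupled_index_form =
  fixes L :: lagrangian and x :: "real \<Rightarrow> real ^ 2" and T \<omega> A B \<kappa> c :: real
  assumes \<omega>_pos: "\<omega> > 0" and T_eq: "T = 2 * pi / \<omega>" and A_pos: "A > 0" and B_pos: "B > 0"
    and index_form_eq: "\<And>u. index_form L x T u =
      (\<integral>t. A * (weak_deriv T u t $ 1)\<^sup>2 + B * (weak_deriv T u t $ 2)\<^sup>2
        + 2 * B * \<kappa> * (u t $ 1 * weak_deriv T u t $ 2) + c * (u t $ 1)\<^sup>2 \<partial>lebesgue_upto T)"
begin

definition mode :: "int \<Rightarrow> real" where
  "mode k = A * (of_int k * \<omega>)\<^sup>2 + c - B * \<kappa>\<^sup>2"

abbreviation M :: "real measure" where "M \<equiv> lebesgue_upto T"

lemma T_pos: "T > 0"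
  using \<omega>_pos T_eq by simp

sublocale hartley: orthogonal_family M "hartley \<omega>" T
  unfolding T_eq by (rule orthogonal_family_hartley [OF \<omega>_pos])

lemma integral_square_le:
  assumes "square_integrable M f"
  shows "(\<integral>t. f t \<partial>M)\<^sup>2 \<le> T * (\<integral>t. (f t)\<^sup>2 \<partial>M)"
  using hartley.bessel_inequality [OF assms, of "{0}"] by simp

text \<open>\<open>T * U\<close> splits into the squared mean \<open>m^2\<close> and the variance
  part \<open>T * U - m^2\<close>. Wirtinger's inequality pays for the variance with weight
  \<open>mode n\<close>. For the mean, \<open>w2\<close> integrates to 0 by periodicity, so the
  completed square has mean part \<open>\<kappa> * m\<close> and contributes at least
  \<open>B * \<kappa>^2 * m^2\<close>; this offsets the same amount lost by completing the square
  and leaves \<open>c * m^2\<close>.\<close>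

lemma index_form_nonneg:
  fixes n :: nat
  assumes u: "u \<in> sobolev_loops T" and n: "mode (int n) \<ge> 0"
    and vanish: "\<And>k. k \<noteq> 0 \<Longrightarrow> \<bar>k\<bar> < int n \<Longrightarrow> (\<integral>t. u t $ 1 * hartley \<omega> k t \<partial>M) = 0"
    and mean: "c < 0 \<Longrightarrow> (\<integral>t. u t $ 1 \<partial>M) = 0"
  shows "index_form L x T u \<ge> 0"
proof -
  define w where "w = weak_deriv T u"
  define u1 where "u1 t = u t $ 1" for t
  define w1 where "w1 t = w t $ 1" for t
  define w2 where "w2 t = w t $ 2" for t
  have "has_weak_deriv T u w"
    unfolding w_def by (rule has_weak_deriv_weak_deriv [OF u])
  then have wd: "real_weak_deriv T u1 w1" "real_weak_deriv T (\<lambda>t. u t $ 2) w2"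
    unfolding has_weak_deriv_iff u1_def [abs_def] w1_def [abs_def] w2_def [abs_def] by blast+
  have per: "u (t + T) = u t" for t
    using u by (simp add: sobolev_loops_def)
  have cont: "continuous_on S u1" for S
    unfolding u1_def by (intro continuous_intros continuous_on_apply_bcontfun)
  have sq: "square_integrable M u1" "square_integrable M w1" "square_integrable M w2"
    using square_integrable_lebesgue_upto_continuous [OF cont] wd
    by (auto intro: real_weak_derivD)
  have sqf: "square_integrable M (\<lambda>t. w2 t + \<kappa> * u1 t)"
    by (intro square_integrable_add square_integrable_scale sq)
  note fin = finite_measure_lebesgue_upto
  note int = sq [THEN square_integrable_imp_integrable [OF fin]]
  have w2_mean: "(\<integral>t. w2 t \<partial>M) = 0"
  proof -
    have "(\<integral>t. w2 t \<partial>M) = (\<integral>t. indicator {0..T} t * w2 t \<partial>M)"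
      by (intro Bochner_Integration.integral_cong) (auto simp: space_lebesgue_upto)
    also have "\<dots> = u T $ 2 - u 0 $ 2"
      using real_weak_derivD(2) [OF wd(2), of T] T_pos by simp
    finally show ?thesis using per [of 0] by simp
  qed
  define U where "U = (\<integral>t. (u1 t)\<^sup>2 \<partial>M)"
  define m where "m = (\<integral>t. u1 t \<partial>M)"
  define W where "W = (\<integral>t. (w1 t)\<^sup>2 \<partial>M)"
  define F where "F = (\<integral>t. (w2 t + \<kappa> * u1 t)\<^sup>2 \<partial>M)"
  have "index_form L x T u = (\<integral>t. A * (w1 t)\<^sup>2 + B * (w2 t + \<kappa> * u1 t)\<^sup>2 + (c - B * \<kappa>\<^sup>2) * (u1 t)\<^sup>2 \<partial>M)"
    unfolding index_form_eq w_def [symmetric] u1_def [symmetric] w1_def [symmetric] w2_def [symmetric]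
    by (intro Bochner_Integration.integral_cong refl) algebra
  also have "\<dots> = A * W + B * F + (c - B * \<kappa>\<^sup>2) * U"
    unfolding W_def F_def U_def using sq sqf by (simp add: square_integrable_def)
  finally have I: "index_form L x T u = A * W + B * F + (c - B * \<kappa>\<^sup>2) * U" .
  have "(\<integral>t. w2 t + \<kappa> * u1 t \<partial>M) = \<kappa> * m"
    using int w2_mean by (simp add: m_def)
  then have F: "\<kappa>\<^sup>2 * m\<^sup>2 \<le> T * F"
    using integral_square_le [OF sqf] by (simp add: F_def power_mult_distrib)
  have U: "m\<^sup>2 \<le> T * U"
    using integral_square_le [OF sq(1)] by (simp add: U_def m_def)
  have W: "(real n * \<omega>)\<^sup>2 * (T * U - m\<^sup>2) \<le> T * W"
    unfolding U_def m_def W_def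
    by (rule wirtinger_inequality [OF \<omega>_pos T_eq cont _ wd(1)])
      (use per vanish in \<open>auto simp: u1_def\<close>)
  have "0 \<le> mode (int n) * (T * U - m\<^sup>2) + c * m\<^sup>2"
  proof -
    have "c * m\<^sup>2 \<ge> 0"
    proof (cases "c < 0")
      case True
      then show ?thesis using mean by (simp add: m_def u1_def)
    qed simp
    moreover have "mode (int n) * (T * U - m\<^sup>2) \<ge> 0"
      using n U by simp
    ultimately show ?thesis by linarith
  qed
  also have "\<dots> = A * ((real n * \<omega>)\<^sup>2 * (T * U - m\<^sup>2)) + B * (\<kappa>\<^sup>2 * m\<^sup>2) + (c - B * \<kappa>\<^sup>2) * (T * U)"
    by (simp add: mode_def algebra_simps)
  also have "\<dots> \<le> A * (T * W) + B * (T * F) + (c - B * \<kappa>\<^sup>2) * (T * U)"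
    using mult_left_mono [OF W, of A] mult_left_mono [OF F, of B] A_pos B_pos by linarith
  also have "\<dots> = T * index_form L x T u"
    unfolding I by (simp add: algebra_simps)
  finally show ?thesis
    using T_pos by (simp add: zero_le_mult_iff)
qed

text \<open>The second component makes the completed square vanish for \<open>k \<noteq> 0\<close>; for \<open>k = 0\<close> it is
  \<open>0\<close> by the convention for division.\<close>

definition mode_fun :: "int \<Rightarrow> real \<Rightarrow> real ^ 2" where
  "mode_fun k t = vector [hartley \<omega> k t, \<kappa> / (of_int k * \<omega>) * hartley \<omega> (- k) t]"

definition mode_loop :: "int \<Rightarrow> real \<Rightarrow>\<^sub>C (real ^ 2)" where
  "mode_loop k = Bcontfun (mode_fun k)"

lemma mode_fun_nth [simp]:
  "mode_fun k t $ 1 = hartley \<omega> k t"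
  "mode_fun k t $ 2 = \<kappa> / (of_int k * \<omega>) * hartley \<omega> (- k) t"
  by (simp_all add: mode_fun_def vector_2)

lemma apply_mode_loop: "apply_bcontfun (mode_loop k) = mode_fun k"
  unfolding mode_loop_def
proof (rule Bcontfun_inverse, rule bcontfun_normI)
  have eq: "mode_fun k = (\<lambda>t. \<chi> i. mode_fun k t $ i)"
    by simp
  have "continuous_on UNIV (\<lambda>t. mode_fun k t $ 1)" "continuous_on UNIV (\<lambda>t. mode_fun k t $ 2)"
    unfolding mode_fun_nth by (intro continuous_intros)+
  then have "continuous_on UNIV (\<lambda>t. mode_fun k t $ i)" for i
    using exhaust_2 [of i] by metis
  then show "continuous_on UNIV (mode_fun k)"
    by (subst eq) (intro continuous_on_vec_lambda)
  show "norm (mode_fun k t) \<le> 2 + \<bar>\<kappa> / (of_int k * \<omega>)\<bar> * 2" for t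
  proof -
    have "norm (mode_fun k t) \<le> \<bar>hartley \<omega> k t\<bar> + \<bar>\<kappa> / (of_int k * \<omega>)\<bar> * \<bar>hartley \<omega> (- k) t\<bar>"
      using norm_le_l1_cart [of "mode_fun k t"] by (simp add: sum_2 abs_mult)
    also have "\<dots> \<le> 2 + \<bar>\<kappa> / (of_int k * \<omega>)\<bar> * 2"
      by (intro add_mono mult_left_mono abs_hartley_le) auto
    finally show ?thesis .
  qed
qed

lemma apply_sum_mode_loop:
  "apply_bcontfun (\<Sum>k\<in>J. y k *\<^sub>R mode_loop k) t = (\<Sum>k\<in>J. y k *\<^sub>R mode_fun k t)"
proof (induction J rule: infinite_finite_induct)
  case (insert k J)
  then show ?case by (simp add: apply_mode_loop)
qed simp_all

text \<open>The second component is \<open>- \<kappa>\<close> times the nonconstant part of the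
  loop's first component, so the completed square retains only the constant
  \<open>\<kappa> * y 0\<close>, present when \<open>0 \<in> J\<close>.\<close>

definition mode_sum_deriv :: "int set \<Rightarrow> (int \<Rightarrow> real) \<Rightarrow> real \<Rightarrow> real ^ 2" where
  "mode_sum_deriv J y t = vector [\<Sum>k\<in>J. (y k * (of_int k * \<omega>)) * hartley \<omega> (- k) t,
     \<Sum>k\<in>J. (if k = 0 then 0 else - \<kappa> * y k) * hartley \<omega> k t]"

lemma mode_sum_deriv_nth [simp]:
  "mode_sum_deriv J y t $ 1 = (\<Sum>k\<in>J. (y k * (of_int k * \<omega>)) * hartley \<omega> (- k) t)"
  "mode_sum_deriv J y t $ 2 = (\<Sum>k\<in>J. (if k = 0 then 0 else - \<kappa> * y k) * hartley \<omega> k t)"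
  by (simp_all add: mode_sum_deriv_def vector_2)

lemma has_weak_deriv_mode_sum:
  "has_weak_deriv T (apply_bcontfun (\<Sum>k\<in>J. y k *\<^sub>R mode_loop k)) (mode_sum_deriv J y)"
  unfolding has_weak_deriv_iff
proof
  fix i :: 2
  have "real_weak_deriv T (\<lambda>t. \<Sum>k\<in>J. y k * hartley \<omega> k t)
      (\<lambda>t. \<Sum>k\<in>J. (y k * (of_int k * \<omega>)) * hartley \<omega> (- k) t)"
    by (rule real_weak_deriv_smooth)
      (auto intro!: derivative_eq_intros continuous_intros sum.cong simp: mult_ac)
  moreover have "real_weak_deriv T (\<lambda>t. \<Sum>k\<in>J. y k * (\<kappa> / (of_int k * \<omega>) * hartley \<omega> (- k) t))
      (\<lambda>t. \<Sum>k\<in>J. (if k = 0 then 0 else - \<kappa> * y k) * hartley \<omega> k t)"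
  proof (rule real_weak_deriv_smooth)
    fix t
    have "((\<lambda>t. \<Sum>k\<in>J. y k * (\<kappa> / (of_int k * \<omega>) * hartley \<omega> (- k) t)) has_real_derivative
        (\<Sum>k\<in>J. y k * (\<kappa> / (of_int k * \<omega>) * (of_int (- k) * \<omega> * hartley \<omega> (- (- k)) t)))) (at t)"
      by (intro DERIV_sum DERIV_cmult hartley_has_real_derivative)
    also have "(\<Sum>k\<in>J. y k * (\<kappa> / (of_int k * \<omega>) * (of_int (- k) * \<omega> * hartley \<omega> (- (- k)) t)))
        = (\<Sum>k\<in>J. (if k = 0 then 0 else - \<kappa> * y k) * hartley \<omega> k t)"
      using \<omega>_pos by (intro sum.cong refl) auto
    finally show "((\<lambda>t. \<Sum>k\<in>J. y k * (\<kappa> / (of_int k * \<omega>) * hartley \<omega> (- k) t)) has_real_derivative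
        (\<Sum>k\<in>J. (if k = 0 then 0 else - \<kappa> * y k) * hartley \<omega> k t)) (at t)" .
  qed (intro continuous_intros)
  ultimately show "real_weak_deriv T (\<lambda>t. apply_bcontfun (\<Sum>k\<in>J. y k *\<^sub>R mode_loop k) t $ i)
      (\<lambda>t. mode_sum_deriv J y t $ i)"
    using exhaust_2 [of i] by (auto simp: apply_sum_mode_loop)
qed

lemma mode_sum_in_sobolev_loops: "(\<Sum>k\<in>J. y k *\<^sub>R mode_loop k) \<in> sobolev_loops T"
  unfolding sobolev_loops_def
proof (intro CollectI conjI allI exI)
  show "has_weak_deriv T (apply_bcontfun (\<Sum>k\<in>J. y k *\<^sub>R mode_loop k)) (mode_sum_deriv J y)"
    by (rule has_weak_deriv_mode_sum)
  have "mode_fun k (t + T) = mode_fun k t" for k t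
    using hartley_periodic [of \<omega>] \<omega>_pos by (simp add: mode_fun_def T_eq)
  then show "apply_bcontfun (\<Sum>k\<in>J. y k *\<^sub>R mode_loop k) (t + T)
      = apply_bcontfun (\<Sum>k\<in>J. y k *\<^sub>R mode_loop k) t" for t
    by (simp add: apply_sum_mode_loop)
qed

text \<open>Almost everywhere uniqueness allows the explicit derivative under the integral, and
  orthogonality diagonalises every product. For \<open>k \<noteq> 0\<close> the terms
  \<open>B * \<kappa>^2\<close> and \<open>- 2 * B * \<kappa>^2\<close> from the angular part
  combine to the correction in \<open>mode k\<close>; for \<open>k = 0\<close> the angular part is
  absent and \<open>c\<close> remains.\<close>

lemma index_form_mode_sum:
  assumes J: "finite J"
  shows "index_form L x T (apply_bcontfun (\<Sum>k\<in>J. y k *\<^sub>R mode_loop k))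
    = T * (\<Sum>k\<in>J. (if k = 0 then c else mode k) * (y k)\<^sup>2)"
proof -
  define u where "u = apply_bcontfun (\<Sum>k\<in>J. y k *\<^sub>R mode_loop k)"
  define w where "w = weak_deriv T u"
  define u1 where "u1 t = (\<Sum>k\<in>J. y k * hartley \<omega> k t)" for t
  define w1 where "w1 t = (\<Sum>k\<in>J. (y k * (of_int k * \<omega>)) * hartley \<omega> (- k) t)" for t
  define w2 where "w2 t = (\<Sum>k\<in>J. (if k = 0 then 0 else - \<kappa> * y k) * hartley \<omega> k t)" for t
  \<comment> \<open>Differentiation reverses orders, so the first velocity component is a
    combination of the reversed family with coefficients indexed by \<open>J\<close>.\<close>
  interpret neg: orthogonal_family M "\<lambda>k. hartley \<omega> (- k)" T
    by unfold_locales (use hartley.e hartley.ortho hartley.T_pos in auto)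
  have u1: "u t $ 1 = u1 t" for t
    by (simp add: u_def u1_def apply_sum_mode_loop)
  have "has_weak_deriv T u w"
    unfolding w_def u_def by (rule has_weak_deriv_weak_deriv [OF mode_sum_in_sobolev_loops])
  moreover have "has_weak_deriv T u (mode_sum_deriv J y)"
    unfolding u_def by (rule has_weak_deriv_mode_sum)
  ultimately have wd: "real_weak_deriv T (\<lambda>t. u t $ i) (\<lambda>t. w t $ i)"
      "real_weak_deriv T (\<lambda>t. u t $ i) (\<lambda>t. mode_sum_deriv J y t $ i)" for i
    unfolding has_weak_deriv_iff by blast+
  have ae1: "AE t in M. w t $ 1 = w1 t"
    using real_weak_deriv_unique [OF wd] unfolding w1_def mode_sum_deriv_nth(1) [symmetric] .
  have ae2: "AE t in M. w t $ 2 = w2 t"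
    using real_weak_deriv_unique [OF wd] unfolding w2_def mode_sum_deriv_nth(2) [symmetric] .
  have sq: "square_integrable M u1" "square_integrable M w1" "square_integrable M w2"
    unfolding u1_def [abs_def] w1_def [abs_def] w2_def [abs_def]
    by (intro hartley.square_integrable_lincomb neg.square_integrable_lincomb)+
  have meas: "(\<lambda>t. w t $ i) \<in> borel_measurable M" "u1 \<in> borel_measurable M"
      "w1 \<in> borel_measurable M" "w2 \<in> borel_measurable M" for i
    using wd(1) [of i] sq by (auto simp: real_weak_deriv_def square_integrable_def)
  have "index_form L x T u = (\<integral>t. A * (w t $ 1)\<^sup>2 + B * (w t $ 2)\<^sup>2
        + 2 * B * \<kappa> * (u1 t * w t $ 2) + c * (u1 t)\<^sup>2 \<partial>M)"
    unfolding index_form_eq w_def [symmetric] u1 ..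
  also have "\<dots> = (\<integral>t. A * (w1 t * w1 t) + B * (w2 t * w2 t)
        + 2 * B * \<kappa> * (u1 t * w2 t) + c * (u1 t * u1 t) \<partial>M)"
  proof (rule integral_cong_AE)
    show "AE t in M. A * (w t $ 1)\<^sup>2 + B * (w t $ 2)\<^sup>2 + 2 * B * \<kappa> * (u1 t * w t $ 2) + c * (u1 t)\<^sup>2
        = A * (w1 t * w1 t) + B * (w2 t * w2 t) + 2 * B * \<kappa> * (u1 t * w2 t) + c * (u1 t * u1 t)"
      using ae1 ae2 by eventually_elim (simp add: power2_eq_square)
  qed (use meas in measurable)
  also have "\<dots> = A * (\<integral>t. w1 t * w1 t \<partial>M) + B * (\<integral>t. w2 t * w2 t \<partial>M)
      + 2 * B * \<kappa> * (\<integral>t. u1 t * w2 t \<partial>M) + c * (\<integral>t. u1 t * u1 t \<partial>M)"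
    using sq [THEN square_integrable_mult] sq by simp
  also have "(\<integral>t. w1 t * w1 t \<partial>M) = T * (\<Sum>k\<in>J. (y k * (of_int k * \<omega>)) * (y k * (of_int k * \<omega>)))"
    unfolding w1_def by (rule neg.integral_lincomb_mult_lincomb [OF J])
  also have "(\<integral>t. w2 t * w2 t \<partial>M)
      = T * (\<Sum>k\<in>J. (if k = 0 then 0 else - \<kappa> * y k) * (if k = 0 then 0 else - \<kappa> * y k))"
    unfolding w2_def by (rule hartley.integral_lincomb_mult_lincomb [OF J])
  also have "(\<integral>t. u1 t * w2 t \<partial>M) = T * (\<Sum>k\<in>J. y k * (if k = 0 then 0 else - \<kappa> * y k))"
    unfolding u1_def w2_def by (rule hartley.integral_lincomb_mult_lincomb [OF J])
  also have "(\<integral>t. u1 t * u1 t \<partial>M) = T * (\<Sum>k\<in>J. y k * y k)"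
    unfolding u1_def by (rule hartley.integral_lincomb_mult_lincomb [OF J])
  also have "A * (T * (\<Sum>k\<in>J. (y k * (of_int k * \<omega>)) * (y k * (of_int k * \<omega>))))
      + B * (T * (\<Sum>k\<in>J. (if k = 0 then 0 else - \<kappa> * y k) * (if k = 0 then 0 else - \<kappa> * y k)))
      + 2 * B * \<kappa> * (T * (\<Sum>k\<in>J. y k * (if k = 0 then 0 else - \<kappa> * y k)))
      + c * (T * (\<Sum>k\<in>J. y k * y k))
      = (\<Sum>k\<in>J. T * ((if k = 0 then c else mode k) * (y k)\<^sup>2))"
    unfolding sum_distrib_left sum.distrib [symmetric]
    by (intro sum.cong refl) (simp add: mode_def power2_eq_square algebra_simps)
  finally show ?thesis
    by (simp add: u_def sum_distrib_left)
qed

text \<open>\<open>n\<close> is the first positive order with nonnegative weight. As weights grow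
  with the absolute value of the order, the negative harmonics are the orders 1 to
  \<open>n - 1\<close>, each counted twice for its sign, and the mean if
  \<open>c < 0\<close>.\<close>

theorem morse_index_eq:
  fixes n :: nat
  assumes n: "n \<ge> 1" and nonneg: "mode (int n) \<ge> 0"
    and neg: "\<And>k. 0 < k \<Longrightarrow> k < n \<Longrightarrow> mode (int k) < 0"
  shows "morse_index L x T = enat ((if c < 0 then 1 else 0) + 2 * (n - 1))"
proof -
  define J where "J = ({1 - int n..int n - 1} - {0}) \<union> (if c < 0 then {0} else {})"
  have J: "finite J"
    by (simp add: J_def)
  have "card ({1 - int n..int n - 1} - {0}) = 2 * (n - 1)"
    using n by (subst card_Diff_singleton) auto
  moreover have "card (P \<union> (if c < 0 then {0} else {})) = (if c < 0 then 1 else 0) + card P"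
    if "finite P" "0 \<notin> P" for P :: "int set"
    using that by simp
  ultimately have card_J: "card J = (if c < 0 then 1 else 0) + 2 * (n - 1)"
    unfolding J_def by (metis Diff_iff finite_Diff finite_atLeastAtMost_int insertI1)
  have J_neg: "(if k = 0 then c else mode k) < 0" if "k \<in> J" for k
  proof (cases "k = 0")
    case False
    have "mode k = mode (int (nat \<bar>k\<bar>))"
      by (simp add: mode_def power_mult_distrib)
    moreover have "mode (int (nat \<bar>k\<bar>)) < 0"
      using that False by (intro neg) (auto simp: J_def split: if_splits)
    ultimately show ?thesis
      using False by simp
  qed (use that in \<open>auto simp: J_def split: if_splits\<close>)
  have "enat (dim V) \<le> enat (card J)"
    if V: "subspace V" "finite B" "V \<subseteq> span B" "V \<subseteq> sobolev_loops T"
      and negdef: "\<forall>u\<in>V. u \<noteq> 0 \<longrightarrow> index_form L x T (apply_bcontfun u) < 0" for V B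
  \<comment> \<open>A larger \<open>V\<close> would contain a nonzero loop whose radial component is
    orthogonal to all harmonics in \<open>J\<close>, where the form is nonnegative.\<close>
  proof (rule ccontr)
    define f where "f k u = (\<integral>t. apply_bcontfun u t $ 1 * hartley \<omega> k t \<partial>M)"
      for k and u :: "real \<Rightarrow>\<^sub>C (real ^ 2)"
    have int: "integrable M (\<lambda>t. apply_bcontfun u t $ 1 * hartley \<omega> k t)"
      for k and u :: "real \<Rightarrow>\<^sub>C (real ^ 2)"
      by (intro integrable_lebesgue_upto_continuous continuous_intros continuous_on_apply_bcontfun)
    have lin: "linear (f k)" for k
      by (rule linearI) (simp_all add: f_def distrib_right int mult.assoc)
    assume "\<not> enat (dim V) \<le> enat (card J)"
    then have "card J < dim V" by simp
    from exists_nonzero_in_common_kernel [where f = f, OF J V(1-3) lin this]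
    obtain u where u: "u \<in> V" "u \<noteq> 0" and fu: "\<And>k. k \<in> J \<Longrightarrow> f k u = 0"
      by blast
    have "index_form L x T u \<ge> 0"
    proof (rule index_form_nonneg [OF _ nonneg])
      show "u \<in> sobolev_loops T" using u V by blast
      show "(\<integral>t. u t $ 1 * hartley \<omega> k t \<partial>M) = 0" if "k \<noteq> 0" "\<bar>k\<bar> < int n" for k
      proof -
        have "k \<in> J" using that by (auto simp: J_def)
        from fu [OF this] show ?thesis by (simp add: f_def)
      qed
      show "(\<integral>t. u t $ 1 \<partial>M) = 0" if "c < 0"
      proof -
        have "0 \<in> J" using that by (simp add: J_def)
        from fu [OF this] show ?thesis by (simp add: f_def)
      qed
    qed
    then show False
      using negdef u by force
  qed
  then have upper: "morse_index L x T \<le> enat (card J)"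
    unfolding morse_index_def by (intro Sup_least) auto
  \<comment> \<open>The radial components alone decide: they are Hartley functions, and pairing with
    the one of order \<open>j\<close> isolates \<open>y j\<close>.\<close>
  have indep: "y j = 0" if "(\<Sum>k\<in>J. y k *\<^sub>R mode_loop k) = 0" "j \<in> J" for y j
  proof -
    have "(\<Sum>k\<in>J. y k * hartley \<omega> k t) = 0" for t
      using that(1) apply_sum_mode_loop [of y J t] by (simp add: vec_eq_iff forall_2)
    then have "T * y j = 0"
      using hartley.integral_lincomb_mult_basis [OF J, of y j] that(2) by simp
    then show ?thesis using T_pos by simp
  qed
  have inj: "inj_on mode_loop J"
  proof (rule inj_onI, rule ccontr)
    fix i j assume ij: "i \<in> J" "j \<in> J" "mode_loop i = mode_loop j" "i \<noteq> j"
    \<comment> \<open>Equal loops of different orders would give a vanishing combination with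
      coefficients 1 and -1.\<close>
    have "(\<Sum>k\<in>J. ((if k = i then 1 else 0) - (if k = j then 1 else 0)) *\<^sub>R mode_loop k) = 0"
      using ij J by (simp add: scaleR_diff_left sum_subtractf if_distrib [of "\<lambda>a. a *\<^sub>R _"] cong: if_cong)
    from indep [OF this ij(1)] ij(4) show False by simp
  qed
  let ?V = "span (mode_loop ` J)"
  have "independent (mode_loop ` J)"
    unfolding dependent_finite [OF finite_imageI [OF J]] sum.reindex [OF inj] o_def
    using indep [of "\<lambda>k. z (mode_loop k)" for z] by blast
  then have "dim ?V = card J"
    using card_image [OF inj] by (simp add: dim_eq_card_independent)
  moreover have elem: "\<exists>y. u = (\<Sum>k\<in>J. y k *\<^sub>R mode_loop k)" if "u \<in> ?V" for u
  proof -
    have "u \<in> range (\<lambda>z. \<Sum>k\<in>J. z (mode_loop k) *\<^sub>R mode_loop k)"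
      using that unfolding span_finite [OF finite_imageI [OF J]] sum.reindex [OF inj] o_def .
    then obtain z where "u = (\<Sum>k\<in>J. z (mode_loop k) *\<^sub>R mode_loop k)"
      by (rule rangeE)
    then show ?thesis by (intro exI [of _ "\<lambda>k. z (mode_loop k)"])
  qed
  moreover have "?V \<subseteq> sobolev_loops T"
    using elem mode_sum_in_sobolev_loops by blast
  moreover have "index_form L x T u < 0" if u: "u \<in> ?V" "u \<noteq> 0" for u
  proof -
    obtain y where y: "u = (\<Sum>k\<in>J. y k *\<^sub>R mode_loop k)"
      using elem [OF u(1)] by blast
    have "u = 0" if "\<forall>j\<in>J. y j = 0"
      unfolding y using that by (intro sum.neutral) simp
    then obtain j where j: "j \<in> J" "y j \<noteq> 0"
      using u(2) by blast
    have "0 < (\<Sum>k\<in>J. - ((if k = 0 then c else mode k) * (y k)\<^sup>2))"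
    proof (rule sum_pos2 [OF J j(1)])
      show "0 < - ((if j = 0 then c else mode j) * (y j)\<^sup>2)"
        using J_neg [OF j(1)] j(2) by (simp add: mult_less_0_iff)
      show "0 \<le> - ((if k = 0 then c else mode k) * (y k)\<^sup>2)" if "k \<in> J" for k
        using J_neg [OF that] by (simp add: mult_le_0_iff)
    qed
    then show ?thesis
      unfolding y index_form_mode_sum [OF J] using T_pos by (simp add: sum_negf mult_less_0_iff)
  qed
  ultimately have "enat (card J) \<le> morse_index L x T"
    unfolding morse_index_def using J
    by (intro Sup_upper CollectI exI [of _ ?V]) auto
  with upper show ?thesis
    by (simp add: card_J)
qed

end

section \<open>Second variation along circular curves\<close>

text \<open>Agreement of \<open>F\<close> and \<open>g\<close> on the open half-plane of positive
  radius suffices. Second partial derivatives can thus be computed from formulas for the first ones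
  that are established only there.\<close>

lemma partial_deriv_1_eq:
  assumes "\<And>y. y $ 1 > 0 \<Longrightarrow> F y = g (y $ 1) (y $ 2)" "x $ 1 > 0"
    and "((\<lambda>r. g r (x $ 2)) has_real_derivative D) (at (x $ 1))"
  shows "partial_deriv 1 F (x :: real ^ 2) = D"
proof -
  have "((\<lambda>s. g (s + x $ 1) (x $ 2)) has_real_derivative D) (at 0)"
    using DERIV_shift [of "\<lambda>r. g r (x $ 2)" D 0 "x $ 1"] assms(3) by simp
  then have "((\<lambda>s. F (x + s *\<^sub>R axis 1 1)) has_real_derivative D) (at 0)"
  proof (rule has_field_derivative_transform_within_open)
    show "open {- (x $ 1)<..}" "0 \<in> {- (x $ 1)<..}"
      using assms(2) by auto
    show "g (s + x $ 1) (x $ 2) = F (x + s *\<^sub>R axis 1 1)" if "s \<in> {- (x $ 1)<..}" for s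
      using assms(1) [of "x + s *\<^sub>R axis 1 1"] that by (simp add: axis_def add.commute)
  qed
  then show ?thesis
    unfolding partial_deriv_def by (rule DERIV_imp_deriv)
qed

lemma partial_deriv_2_eq:
  assumes "\<And>y. y $ 1 > 0 \<Longrightarrow> F y = g (y $ 1) (y $ 2)" "x $ 1 > 0"
    and "((\<lambda>r. g (x $ 1) r) has_real_derivative D) (at (x $ 2))"
  shows "partial_deriv 2 F (x :: real ^ 2) = D"
proof -
  have "((\<lambda>s. g (x $ 1) (s + x $ 2)) has_real_derivative D) (at 0)"
    using DERIV_shift [of "\<lambda>r. g (x $ 1) r" D 0 "x $ 2"] assms(3) by simp
  moreover have "(\<lambda>s. F (x + s *\<^sub>R axis 2 1)) = (\<lambda>s. g (x $ 1) (s + x $ 2))"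
    using assms(1) [of "x + s *\<^sub>R axis 2 1" for s] assms(2) by (simp add: axis_def add.commute)
  ultimately show ?thesis
    unfolding partial_deriv_def by (simp add: DERIV_imp_deriv)
qed

lemma partial_deriv_velocity:
  "partial_deriv 1 (polar_lagrangian p q z) v = p (z $ 1) * v $ 1"
  "partial_deriv 2 (polar_lagrangian p q z) v = p (z $ 1) * (z $ 1)\<^sup>2 * v $ 2"
  unfolding partial_deriv_def polar_lagrangian_def
  by (rule DERIV_imp_deriv, auto simp: axis_def intro!: derivative_eq_intros)+

lemma velocity_circular_curve: "velocity (circular_curve \<xi> \<theta> \<omega>) t = vector [0, \<omega>]"
proof -
  have "circular_curve \<xi> \<theta> \<omega> = (\<lambda>t. vector [\<xi>, \<theta>] + t *\<^sub>R vector [0, \<omega>])"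
    by (auto simp: circular_curve_def fun_eq_iff vec_eq_iff forall_2 vector_2)
  moreover have "((\<lambda>t. vector [\<xi>, \<theta>] + t *\<^sub>R vector [0, \<omega>]) has_vector_derivative
      (vector [0, \<omega>] :: real ^ 2)) (at t)"
    by (auto intro!: derivative_eq_intros)
  ultimately show ?thesis
    unfolding velocity_def by (simp add: vector_derivative_at)
qed

text \<open>The first derivatives are given on all positive radii because they are differentiated
  once more; second derivatives matter only at \<open>\<xi>\<close>.\<close>

locale polar_circular =
  fixes p q p' q' :: "real \<Rightarrow> real" and p'' q'' \<xi> \<theta> \<omega> :: real
  assumes \<xi>: "\<xi> > 0"
    and p: "\<And>r. r > 0 \<Longrightarrow> (p has_real_derivative p' r) (at r)"
    and q: "\<And>r. r > 0 \<Longrightarrow> (q has_real_derivative q' r) (at r)"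
    and p': "(p' has_real_derivative p'') (at \<xi>)"
    and q': "(q' has_real_derivative q'') (at \<xi>)"
begin

definition \<eta>' :: real where "\<eta>' = p' \<xi> * \<xi>\<^sup>2 + 2 * p \<xi> * \<xi>"

definition \<eta>'' :: real where "\<eta>'' = p'' * \<xi>\<^sup>2 + 4 * p' \<xi> * \<xi> + 2 * p \<xi>"

definition radial_coeff :: real where "radial_coeff = \<eta>'' * \<omega>\<^sup>2 / 2 + q''"

lemma deriv_eta: "deriv (eta p) \<xi> = \<eta>'"
  unfolding eta_def [abs_def] \<eta>'_def
  by (rule DERIV_imp_deriv) (auto intro!: derivative_eq_intros p \<xi>)

lemma deriv_potential: "deriv q \<xi> = q' \<xi>"
  by (rule DERIV_imp_deriv) (rule q [OF \<xi>])

abbreviation L :: lagrangian where "L \<equiv> polar_lagrangian p q"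

abbreviation x :: "real \<Rightarrow> real ^ 2" where "x \<equiv> circular_curve \<xi> \<theta> \<omega>"

abbreviation v :: "real ^ 2" where "v \<equiv> vector [0, \<omega>]"

lemma x_nth [simp]: "x t $ 1 = \<xi>" "x t $ 2 = \<theta> + \<omega> * t"
  by (simp_all add: circular_curve_def vector_2)

lemma partial_deriv_position:
  assumes "z $ 1 > 0"
  shows "partial_deriv 1 (\<lambda>z. L z v) z
      = (p' (z $ 1) * (z $ 1)\<^sup>2 + 2 * p (z $ 1) * z $ 1) * \<omega>\<^sup>2 / 2 + q' (z $ 1)"
    and "partial_deriv 2 (\<lambda>z. L z v) z = 0"
proof -
  show "partial_deriv 1 (\<lambda>z. L z v) z
      = (p' (z $ 1) * (z $ 1)\<^sup>2 + 2 * p (z $ 1) * z $ 1) * \<omega>\<^sup>2 / 2 + q' (z $ 1)"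
  proof (rule partial_deriv_1_eq [OF _ assms])
    show "L y v = 1/2 * p (y $ 1) * ((y $ 1)\<^sup>2 * \<omega>\<^sup>2) + q (y $ 1)" for y
      by (simp add: polar_lagrangian_def vector_2)
    show "((\<lambda>r. 1/2 * p r * (r\<^sup>2 * \<omega>\<^sup>2) + q r) has_real_derivative
        (p' (z $ 1) * (z $ 1)\<^sup>2 + 2 * p (z $ 1) * z $ 1) * \<omega>\<^sup>2 / 2 + q' (z $ 1)) (at (z $ 1))"
      by (auto intro!: derivative_eq_intros p q assms simp: field_simps)
  qed
  show "partial_deriv 2 (\<lambda>z. L z v) z = 0"
  proof (rule partial_deriv_2_eq [OF _ assms])
    show "L y v = 1/2 * p (y $ 1) * ((y $ 1)\<^sup>2 * \<omega>\<^sup>2) + q (y $ 1)" for y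
      by (simp add: polar_lagrangian_def vector_2)
  qed simp
qed

lemma L_vv_circular: "L_vv L (x t) w $ i $ j = (if i = j then if i = 1 then p \<xi> else p \<xi> * \<xi>\<^sup>2 else 0)"
proof -
  have "partial_deriv 1 (\<lambda>w. partial_deriv 1 (L (x t)) w) w = p \<xi>"
    "partial_deriv 2 (\<lambda>w. partial_deriv 1 (L (x t)) w) w = 0"
    "partial_deriv 1 (\<lambda>w. partial_deriv 2 (L (x t)) w) w = 0"
    "partial_deriv 2 (\<lambda>w. partial_deriv 2 (L (x t)) w) w = p \<xi> * \<xi>\<^sup>2"
    unfolding partial_deriv_velocity x_nth unfolding partial_deriv_def
    by (rule DERIV_imp_deriv, auto simp: axis_def intro!: derivative_eq_intros)+
  then show ?thesis
    using exhaust_2 [of i] exhaust_2 [of j] by (auto simp: L_vv_def)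
qed

lemma L_vx_circular: "L_vx L (x t) v $ i $ j = (if i = 2 \<and> j = 1 then \<eta>' * \<omega> else 0)"
proof -
  have 1: "partial_deriv 1 (\<lambda>y. partial_deriv 1 (L y) v) (x t) = 0"
    "partial_deriv 2 (\<lambda>y. partial_deriv 1 (L y) v) (x t) = 0"
    unfolding partial_deriv_velocity by (simp_all add: vector_2 partial_deriv_def)
  have 2: "partial_deriv 1 (\<lambda>y. partial_deriv 2 (L y) v) (x t) = \<eta>' * \<omega>"
  proof (rule partial_deriv_1_eq)
    show "partial_deriv 2 (L y) v = p (y $ 1) * (y $ 1)\<^sup>2 * \<omega>" for y
      by (simp add: partial_deriv_velocity vector_2)
    show "((\<lambda>r. p r * r\<^sup>2 * \<omega>) has_real_derivative \<eta>' * \<omega>) (at (x t $ 1))"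
      by (auto intro!: derivative_eq_intros p simp: \<eta>'_def \<xi>)
  qed (simp add: \<xi>)
  have "partial_deriv 2 (\<lambda>y. partial_deriv 2 (L y) v) (x t) = 0"
    unfolding partial_deriv_velocity by (simp add: partial_deriv_def axis_def)
  with 1 2 show ?thesis
    using exhaust_2 [of i] exhaust_2 [of j] by (auto simp: L_vx_def)
qed

lemma L_xx_circular: "L_xx L (x t) v $ i $ j = (if i = 1 \<and> j = 1 then radial_coeff else 0)"
proof -
  let ?g = "\<lambda>r s. (p' r * r\<^sup>2 + 2 * p r * r) * \<omega>\<^sup>2 / 2 + q' r"
  have pos: "x t $ 1 > 0" by (simp add: \<xi>)
  have 11: "partial_deriv 1 (\<lambda>y. partial_deriv 1 (\<lambda>z. L z v) y) (x t) = radial_coeff"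
  proof (rule partial_deriv_1_eq [where g = ?g, OF partial_deriv_position(1) pos])
    show "((\<lambda>r. ?g r (x t $ 2)) has_real_derivative radial_coeff) (at (x t $ 1))"
      unfolding x_nth
      by (auto intro!: derivative_eq_intros p p' q' \<xi> simp: radial_coeff_def \<eta>''_def algebra_simps power2_eq_square)
  qed
  have 12: "partial_deriv 2 (\<lambda>y. partial_deriv 1 (\<lambda>z. L z v) y) (x t) = 0"
    by (rule partial_deriv_2_eq [where g = ?g, OF partial_deriv_position(1) pos]) auto
  have 21: "partial_deriv 1 (\<lambda>y. partial_deriv 2 (\<lambda>z. L z v) y) (x t) = 0"
    by (rule partial_deriv_1_eq [where g = "\<lambda>_ _. 0", OF partial_deriv_position(2) pos]) auto
  have 22: "partial_deriv 2 (\<lambda>y. partial_deriv 2 (\<lambda>z. L z v) y) (x t) = 0"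
    by (rule partial_deriv_2_eq [where g = "\<lambda>_ _. 0", OF partial_deriv_position(2) pos]) auto
  show ?thesis
    using 11 12 21 22 exhaust_2 [of i] exhaust_2 [of j] by (auto simp: L_xx_def)
qed

lemma index_form_circular:
  "index_form L x T u = (\<integral>t. p \<xi> * (weak_deriv T u t $ 1)\<^sup>2 + p \<xi> * \<xi>\<^sup>2 * (weak_deriv T u t $ 2)\<^sup>2
      + 2 * (\<eta>' * \<omega>) * (u t $ 1 * weak_deriv T u t $ 2) + radial_coeff * (u t $ 1)\<^sup>2 \<partial>lebesgue_upto T)"
proof -
  have "index_form L x T u = (\<integral>t. (L_vv L (x t) v *v weak_deriv T u t) \<bullet> weak_deriv T u t
        + 2 * ((L_vx L (x t) v *v u t) \<bullet> weak_deriv T u t)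
        + (L_xx L (x t) v *v u t) \<bullet> u t \<partial>lebesgue_upto T)"
    unfolding index_form_def velocity_circular_curve set_lebesgue_integral_def
    by (simp add: integral_restrict_space)
  also have "(\<lambda>t. (L_vv L (x t) v *v weak_deriv T u t) \<bullet> weak_deriv T u t
        + 2 * ((L_vx L (x t) v *v u t) \<bullet> weak_deriv T u t)
        + (L_xx L (x t) v *v u t) \<bullet> u t)
      = (\<lambda>t. p \<xi> * (weak_deriv T u t $ 1)\<^sup>2 + p \<xi> * \<xi>\<^sup>2 * (weak_deriv T u t $ 2)\<^sup>2
      + 2 * (\<eta>' * \<omega>) * (u t $ 1 * weak_deriv T u t $ 2) + radial_coeff * (u t $ 1)\<^sup>2)"
    by (simp add: fun_eq_iff matrix_vector_mult_def inner_vec_def sum_2 L_vv_circular L_vx_circular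
        L_xx_circular power2_eq_square)
  finally show ?thesis .
qed

text \<open>Here \<open>B\<close> is the value of \<open>\<eta>\<close> at \<open>\<xi>\<close>, and
  matching the cross term \<open>2 * B * \<kappa>\<close> with \<open>2 * \<eta>' * \<omega>\<close>
  forces \<open>\<kappa>\<close>.\<close>

lemma coupled_index_form_circular:
  assumes "\<omega> > 0" "p \<xi> > 0"
  shows "coupled_index_form L x (2 * pi / \<omega>) \<omega> (p \<xi>) (p \<xi> * \<xi>\<^sup>2) (\<eta>' * \<omega> / (p \<xi> * \<xi>\<^sup>2)) radial_coeff"
proof
  show "index_form L x (2 * pi / \<omega>) u = (\<integral>t. p \<xi> * (weak_deriv (2 * pi / \<omega>) u t $ 1)\<^sup>2
      + p \<xi> * \<xi>\<^sup>2 * (weak_deriv (2 * pi / \<omega>) u t $ 2)\<^sup>2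
      + 2 * (p \<xi> * \<xi>\<^sup>2) * (\<eta>' * \<omega> / (p \<xi> * \<xi>\<^sup>2)) * (u t $ 1 * weak_deriv (2 * pi / \<omega>) u t $ 2)
      + radial_coeff * (u t $ 1)\<^sup>2 \<partial>lebesgue_upto (2 * pi / \<omega>))" for u
    unfolding index_form_circular using assms \<xi> by simp
qed (use assms \<xi> in auto)

end

section \<open>Derivatives of the given conformal factor and potential\<close>

definition conf_factor' :: "real \<Rightarrow> real" where
  "conf_factor' r = - 8 * r / (1 + r\<^sup>2) ^ 3"

definition arctan_potential' :: "real \<Rightarrow> real \<Rightarrow> real" where
  "arctan_potential' \<alpha> r = \<alpha> * arctan r powr (\<alpha> - 1) / (1 + r\<^sup>2)"

lemma one_plus_square_neq_0: "1 + r\<^sup>2 \<noteq> (0::real)"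
  using zero_le_power2 [of r] by linarith

text \<open>The second derivative of the potential is written as a multiple of the first, so that
  the radial equation can later eliminate the power of \<open>arctan\<close>.\<close>

lemma polar_circular_arctan:
  assumes "\<xi> > 0"
  shows "polar_circular conf_factor (arctan_potential \<alpha>) conf_factor' (arctan_potential' \<alpha>)
    ((40 * \<xi>\<^sup>2 - 8) / (1 + \<xi>\<^sup>2) ^ 4)
    (arctan_potential' \<alpha> \<xi> * ((\<alpha> - 1) / arctan \<xi> - 2 * \<xi>) / (1 + \<xi>\<^sup>2)) \<xi>"
proof
  show "\<xi> > 0" by fact
  show "(conf_factor has_real_derivative conf_factor' r) (at r)" for r
  proof -
    have "((\<lambda>r. 2 / (1 + r\<^sup>2)\<^sup>2) has_real_derivative - 8 * r / (1 + r\<^sup>2) ^ 3) (at r)"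
      using one_plus_square_neq_0 [of r]
      by (auto intro!: derivative_eq_intros simp: divide_simps) algebra
    then show ?thesis
      unfolding conf_factor_def [abs_def] conf_factor'_def .
  qed
  show "(conf_factor' has_real_derivative (40 * \<xi>\<^sup>2 - 8) / (1 + \<xi>\<^sup>2) ^ 4) (at \<xi>)"
    unfolding conf_factor'_def [abs_def] using one_plus_square_neq_0 [of \<xi>]
    by (auto intro!: derivative_eq_intros simp: divide_simps) algebra
  have powr_arctan: "((\<lambda>r. arctan r powr a) has_real_derivative a * arctan r powr (a - 1) / (1 + r\<^sup>2)) (at r)"
    if "r > 0" for a r
    using that zero_less_arctan_iff [of r]
    by (auto intro!: derivative_eq_intros has_real_derivative_powr' simp: divide_simps)
  show "(arctan_potential \<alpha> has_real_derivative arctan_potential' \<alpha> r) (at r)" if "r > 0" for r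
    unfolding arctan_potential_def [abs_def] arctan_potential'_def using that by (rule powr_arctan)
  have A: "arctan \<xi> > 0" using assms by simp
  define R where "R = arctan \<xi> powr (\<alpha> - 1)"
  define S where "S = 1 + \<xi>\<^sup>2"
  have S: "S \<noteq> 0" unfolding S_def by (rule one_plus_square_neq_0)
  have R: "arctan \<xi> powr (\<alpha> - 1 - 1) = R / arctan \<xi>"
    using A powr_diff [of "arctan \<xi>" "\<alpha> - 1" 1] by (simp add: R_def)
  have "((\<lambda>r. \<alpha> * arctan r powr (\<alpha> - 1) / (1 + r\<^sup>2)) has_real_derivative
      (\<alpha> * ((\<alpha> - 1) * arctan \<xi> powr (\<alpha> - 1 - 1) / (1 + \<xi>\<^sup>2)) * (1 + \<xi>\<^sup>2)
        - \<alpha> * arctan \<xi> powr (\<alpha> - 1) * (2 * \<xi>)) / ((1 + \<xi>\<^sup>2) * (1 + \<xi>\<^sup>2))) (at \<xi>)"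
    by (intro DERIV_divide DERIV_cmult powr_arctan assms one_plus_square_neq_0)
       (auto intro!: derivative_eq_intros)
  also have "(\<alpha> * ((\<alpha> - 1) * arctan \<xi> powr (\<alpha> - 1 - 1) / (1 + \<xi>\<^sup>2)) * (1 + \<xi>\<^sup>2)
        - \<alpha> * arctan \<xi> powr (\<alpha> - 1) * (2 * \<xi>)) / ((1 + \<xi>\<^sup>2) * (1 + \<xi>\<^sup>2))
      = arctan_potential' \<alpha> \<xi> * ((\<alpha> - 1) / arctan \<xi> - 2 * \<xi>) / (1 + \<xi>\<^sup>2)"
    unfolding arctan_potential'_def R R_def [symmetric] S_def [symmetric]
    using A S by (simp add: field_simps)
  finally show "(arctan_potential' \<alpha> has_real_derivative
      arctan_potential' \<alpha> \<xi> * ((\<alpha> - 1) / arctan \<xi> - 2 * \<xi>) / (1 + \<xi>\<^sup>2)) (at \<xi>)"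
    unfolding arctan_potential'_def [abs_def] .
qed

section \<open>The parameter regions\<close>

text \<open>\<open>mode_sign \<xi> \<alpha>\<close> has the sign of the weight of the first harmonics.\<close>

definition mode_sign :: "real \<Rightarrow> real \<Rightarrow> real" where
  "mode_sign \<xi> \<alpha> = (1 - \<xi>\<^sup>2) * (- 2 * (1 - \<xi>\<^sup>2) * arctan \<xi> - (\<alpha> - 1) * \<xi>)"

text \<open>The right-hand side is the case \<open>k = 1\<close> of the bracket \<open>k^2 * (1 +
  \<xi>^2)^2 * arctan \<xi> - 4 * (1 - \<xi>^2)^2 * arctan \<xi> + f2 \<xi> \<alpha>\<close>. Its
  value at \<open>k = 0\<close> is \<open>- f1\<close>, and \<open>k = 2\<close> is treated in
  \<open>second_mode_nonneg\<close>.\<close>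

lemma mode_sign_eq:
  "mode_sign \<xi> \<alpha> = (1 + \<xi>\<^sup>2)\<^sup>2 * arctan \<xi> - 4 * (1 - \<xi>\<^sup>2)\<^sup>2 * arctan \<xi> + f2 \<xi> \<alpha>"
  unfolding mode_sign_def f2_def by algebra

lemma f1_eq: "f1 \<xi> \<alpha> = 4 * (1 - \<xi>\<^sup>2)\<^sup>2 * arctan \<xi> - f2 \<xi> \<alpha>"
  unfolding f1_def f2_def by algebra

text \<open>This caps the index at 3. In \<open>Omega2\<close> both summands in \<open>eq\<close>
  are nonnegative. In \<open>Omega1\<close> the worst case is \<open>\<alpha>\<close> near 0, where
  \<open>arctan \<xi> > 1 / 2\<close>, from \<open>pi / 4\<close>, is enough.\<close>

lemma second_mode_nonneg:
  assumes \<xi>: "\<xi> > 0" and region: "(\<xi>, \<alpha>) \<in> Omega1 \<union> Omega2"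
  shows "0 \<le> 4 * (1 + \<xi>\<^sup>2)\<^sup>2 * arctan \<xi> - 4 * (1 - \<xi>\<^sup>2)\<^sup>2 * arctan \<xi> + f2 \<xi> \<alpha>"
proof -
  have A: "arctan \<xi> > 0" using \<xi> by simp
  have eq: "4 * (1 + \<xi>\<^sup>2)\<^sup>2 * arctan \<xi> - 4 * (1 - \<xi>\<^sup>2)\<^sup>2 * arctan \<xi> + f2 \<xi> \<alpha>
      = (1 + 10 * \<xi>\<^sup>2 + \<xi> ^ 4) * arctan \<xi> + \<xi> * ((\<alpha> - 1) * (\<xi>\<^sup>2 - 1))"
    unfolding f2_def by algebra
  consider "\<xi> > 1" "\<alpha> > 0" | "\<xi> < 1" "\<alpha> < 0"
    using region by (auto simp: Omega1_def Omega2_def)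
  then show ?thesis
  proof cases
    case 1
    then have sq: "\<xi>\<^sup>2 > 1" by simp
    have "arctan \<xi> > pi / 4"
      using 1 arctan_less_iff [of 1 \<xi>] arctan_one by simp
    then have half: "arctan \<xi> > 1 / 2"
      using pi_gt3 by linarith
    have "- 1 * (\<xi>\<^sup>2 - 1) \<le> (\<alpha> - 1) * (\<xi>\<^sup>2 - 1)"
      using 1 sq by (intro mult_right_mono) auto
    then have "\<xi> * (- 1 * (\<xi>\<^sup>2 - 1)) \<le> \<xi> * ((\<alpha> - 1) * (\<xi>\<^sup>2 - 1))"
      using \<xi> by (intro mult_left_mono) auto
    moreover have "(1 + 10 * \<xi>\<^sup>2 + \<xi> ^ 4) * (1 / 2) \<le> (1 + 10 * \<xi>\<^sup>2 + \<xi> ^ 4) * arctan \<xi>"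
      using half by (intro mult_left_mono) auto
    \<comment> \<open>Twice the difference is a sum of nonnegative terms.\<close>
    moreover have "\<xi> * (\<xi>\<^sup>2 - 1) \<le> (1 + 10 * \<xi>\<^sup>2 + \<xi> ^ 4) * (1 / 2)"
    proof -
      have "0 \<le> (\<xi>\<^sup>2 - \<xi>)\<^sup>2 + 1 + 9 * \<xi>\<^sup>2 + 2 * \<xi>"
        using \<xi> by (intro add_nonneg_nonneg) auto
      also have "\<dots> = 2 * ((1 + 10 * \<xi>\<^sup>2 + \<xi> ^ 4) * (1 / 2) - \<xi> * (\<xi>\<^sup>2 - 1))"
        by (simp add: field_simps) algebra
      finally show ?thesis by simp
    qed
    ultimately show ?thesis
      unfolding eq by linarith
  next
    case 2
    then have "\<xi>\<^sup>2 < 1"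
      using \<xi> by (simp add: power_less_one_iff)
    then have "(\<alpha> - 1) * (\<xi>\<^sup>2 - 1) \<ge> 0"
      using 2 by (intro mult_nonpos_nonpos) auto
    then have "\<xi> * ((\<alpha> - 1) * (\<xi>\<^sup>2 - 1)) \<ge> 0"
      using \<xi> by simp
    moreover have "(1 + 10 * \<xi>\<^sup>2 + \<xi> ^ 4) * arctan \<xi> \<ge> 0"
      using A by simp
    ultimately show ?thesis
      unfolding eq by linarith
  qed
qed

text \<open>After elimination of the power of \<open>arctan\<close>, every weight is a common
  positive factor \<open>K\<close> times a bracket in which \<open>\<alpha>\<close> occurs only
  inside \<open>f2\<close>, so two signs determine the index.\<close>

lemma circular_solution_morse_index:
  assumes "\<alpha> \<noteq> 0"
    and sol: "circular_solution conf_factor (arctan_potential \<alpha>) \<xi> \<theta> \<omega>"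
  shows "(\<xi>, \<alpha>) \<in> Omega1 \<union> Omega2"
    and "morse_index (polar_lagrangian conf_factor (arctan_potential \<alpha>))
        (circular_curve \<xi> \<theta> \<omega>) (2 * pi / \<omega>)
      = enat ((if f2 \<xi> \<alpha> < 0 then 1 else 0) + (if mode_sign \<xi> \<alpha> < 0 then 2 else 0))"
proof -
  have \<xi>: "\<xi> > 0" and \<omega>: "\<omega> > 0"
    using sol by (auto simp: circular_solution_def)
  have A: "arctan \<xi> > 0" using \<xi> by simp
  interpret polar_circular conf_factor "arctan_potential \<alpha>" conf_factor' "arctan_potential' \<alpha>"
    "(40 * \<xi>\<^sup>2 - 8) / (1 + \<xi>\<^sup>2) ^ 4"
    "arctan_potential' \<alpha> \<xi> * ((\<alpha> - 1) / arctan \<xi> - 2 * \<xi>) / (1 + \<xi>\<^sup>2)" \<xi> \<theta> \<omega>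
    by (rule polar_circular_arctan [OF \<xi>])
  define S where "S = 1 + \<xi>\<^sup>2"
  have S: "S > 0" using zero_le_power2 [of \<xi>] by (simp only: S_def)
  have p\<xi>: "conf_factor \<xi> = 2 / S\<^sup>2"
    by (simp add: conf_factor_def S_def)
  have \<eta>': "\<eta>' = 4 * \<xi> * (1 - \<xi>\<^sup>2) / S ^ 3"
    unfolding \<eta>'_def conf_factor_def conf_factor'_def S_def [symmetric] using S
    by (simp add: divide_simps) (simp add: S_def, algebra)
  have \<eta>'_nz: "\<eta>' \<noteq> 0" and \<omega>2: "\<omega>\<^sup>2 = - 2 * arctan_potential' \<alpha> \<xi> / \<eta>'"
    using sol unfolding circular_solution_def deriv_eta deriv_potential by auto
  then have q': "arctan_potential' \<alpha> \<xi> = - \<omega>\<^sup>2 * \<eta>' / 2"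
    by (simp add: field_simps)
  \<comment> \<open>The radial equation makes the derivative of the potential, with the sign of
    \<open>\<alpha>\<close>, and \<open>\<eta>'\<close>, with the sign of
    \<open>1 - \<xi>^2\<close>, opposite in sign. Multiplying it by \<open>\<xi>^2 - 1\<close> turns
    the right-hand side into a positive multiple of a square, nonzero because \<open>\<eta>'\<close>
    is.\<close>
  have "\<alpha> * (\<xi>\<^sup>2 - 1) > 0"
  proof -
    have "\<alpha> * (arctan \<xi> powr (\<alpha> - 1) / S) = \<omega>\<^sup>2 * (2 * \<xi> / S ^ 3) * (\<xi>\<^sup>2 - 1)"
      using q' S unfolding arctan_potential'_def \<eta>' S_def [symmetric]
      by (simp add: divide_simps) (simp add: algebra_simps)
    then have "(\<alpha> * (\<xi>\<^sup>2 - 1)) * (arctan \<xi> powr (\<alpha> - 1) / S) = \<omega>\<^sup>2 * (2 * \<xi> / S ^ 3) * (\<xi>\<^sup>2 - 1)\<^sup>2"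
      by algebra
    moreover have "\<omega>\<^sup>2 * (2 * \<xi> / S ^ 3) * (\<xi>\<^sup>2 - 1)\<^sup>2 > 0"
      using \<eta>'_nz \<omega> \<xi> S unfolding \<eta>' by auto
    moreover have "arctan \<xi> powr (\<alpha> - 1) / S > 0"
      using A S by simp
    ultimately show ?thesis
      by (metis zero_less_mult_pos2)
  qed
  then have "\<xi> > 1 \<and> \<alpha> > 0 \<or> \<xi> < 1 \<and> \<alpha> < 0"
    using \<xi> abs_square_less_1 [of \<xi>] abs_square_le_1 [of \<xi>] by (auto simp: zero_less_mult_iff)
  with \<xi> show region: "(\<xi>, \<alpha>) \<in> Omega1 \<union> Omega2"
    by (auto simp: Omega1_def Omega2_def)
  \<comment> \<open>\<open>S ^ 4\<close> is the common denominator of \<open>\<eta>''\<close> and,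
    after the radial equation is used, of the potential's second derivative;
    \<open>arctan \<xi>\<close> clears the quotient that remains.\<close>
  define K where "K = 2 * \<omega>\<^sup>2 / (S ^ 4 * arctan \<xi>)"
  have c: "radial_coeff = K * f2 \<xi> \<alpha>"
  proof -
    have \<eta>'': "\<eta>'' = 4 * (1 - 8 * \<xi>\<^sup>2 + 3 * \<xi> ^ 4) / S ^ 4"
      unfolding \<eta>''_def unfolding conf_factor_def conf_factor'_def S_def [symmetric] using S
      by (simp add: divide_simps) (simp add: S_def, algebra)
    have "radial_coeff = 4 * (1 - 8 * \<xi>\<^sup>2 + 3 * \<xi> ^ 4) / S ^ 4 * \<omega>\<^sup>2 / 2
        + - \<omega>\<^sup>2 * (4 * \<xi> * (1 - \<xi>\<^sup>2) / S ^ 3) / 2 * ((\<alpha> - 1) / arctan \<xi> - 2 * \<xi>) / S"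
      unfolding radial_coeff_def unfolding \<eta>'' unfolding q' unfolding \<eta>' S_def [symmetric] ..
    also have "\<dots> = 2 * \<omega>\<^sup>2 / S ^ 4 * (1 - 8 * \<xi>\<^sup>2 + 3 * \<xi> ^ 4
        - \<xi> * (1 - \<xi>\<^sup>2) * ((\<alpha> - 1) / arctan \<xi> - 2 * \<xi>))"
      using S by (simp add: divide_simps) (simp add: algebra_simps eval_nat_numeral)
    also have "\<dots> = 2 * \<omega>\<^sup>2 / S ^ 4 * (f2 \<xi> \<alpha> / arctan \<xi>)"
      unfolding f2_def using A by (simp add: field_simps) (simp add: algebra_simps power2_eq_square eval_nat_numeral)
    finally show ?thesis
      by (simp add: K_def)
  qed
  interpret coupled_index_form L x "2 * pi / \<omega>" \<omega> "conf_factor \<xi>" "conf_factor \<xi> * \<xi>\<^sup>2"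
    "\<eta>' * \<omega> / (conf_factor \<xi> * \<xi>\<^sup>2)" radial_coeff
    by (rule coupled_index_form_circular [OF \<omega>]) (use S in \<open>simp add: p\<xi>\<close>)
  have mode: "mode k = K *
      ((of_int k)\<^sup>2 * (1 + \<xi>\<^sup>2)\<^sup>2 * arctan \<xi> - 4 * (1 - \<xi>\<^sup>2)\<^sup>2 * arctan \<xi> + f2 \<xi> \<alpha>)" for k
  proof -
    \<comment> \<open>The amount \<open>B * \<kappa>^2\<close> that completing the square
      subtracts.\<close>
    have square: "conf_factor \<xi> * \<xi>\<^sup>2 * (\<eta>' * \<omega> / (conf_factor \<xi> * \<xi>\<^sup>2))\<^sup>2
        = K * (4 * (1 - \<xi>\<^sup>2)\<^sup>2 * arctan \<xi>)"
      unfolding p\<xi> \<eta>' K_def using S A \<xi> by (simp add: divide_simps)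
    have kinetic: "conf_factor \<xi> * (of_int k * \<omega>)\<^sup>2
        = K * ((of_int k)\<^sup>2 * S\<^sup>2 * arctan \<xi>)"
      unfolding p\<xi> K_def using S A by (simp add: divide_simps)
    have "mode k = K * ((of_int k)\<^sup>2 * S\<^sup>2 * arctan \<xi>) + K * f2 \<xi> \<alpha>
        - K * (4 * (1 - \<xi>\<^sup>2)\<^sup>2 * arctan \<xi>)"
      unfolding square [symmetric] kinetic [symmetric] c [symmetric] by (rule mode_def)
    also have "\<dots> = K * ((of_int k)\<^sup>2 * S\<^sup>2 * arctan \<xi> - 4 * (1 - \<xi>\<^sup>2)\<^sup>2 * arctan \<xi> + f2 \<xi> \<alpha>)"
      by algebra
    finally show ?thesis
      by (simp only: S_def)
  qed
  have pos: "K > 0"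
    using \<omega> S A by (simp add: K_def)
  have c_neg: "radial_coeff < 0 \<longleftrightarrow> f2 \<xi> \<alpha> < 0"
    unfolding c using pos by (simp only: mult_less_0_iff) auto
  have mode1: "mode 1 < 0 \<longleftrightarrow> mode_sign \<xi> \<alpha> < 0"
    unfolding mode mode_sign_eq using pos by (simp only: mult_less_0_iff) auto
  have mode2: "mode 2 \<ge> 0"
    using mult_nonneg_nonneg [OF less_imp_le [OF pos] second_mode_nonneg [OF \<xi> region]]
    by (simp add: mode)
  show "morse_index L x (2 * pi / \<omega>)
      = enat ((if f2 \<xi> \<alpha> < 0 then 1 else 0) + (if mode_sign \<xi> \<alpha> < 0 then 2 else 0))"
  \<comment> \<open>Since \<open>mode 2\<close> is nonnegative, the first positive order with
    nonnegative weight is 2 or 1.\<close>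
  proof (cases "mode 1 < 0")
    case True
    have "morse_index L x (2 * pi / \<omega>) = enat ((if radial_coeff < 0 then 1 else 0) + 2 * (2 - 1))"
    proof (rule morse_index_eq)
      show "mode (int k) < 0" if "0 < k" "k < 2" for k
      proof -
        have "k = 1" using that by simp
        with True show ?thesis by simp
      qed
    qed (use mode2 in auto)
    then show ?thesis using True by (simp add: c_neg mode1)
  next
    case False
    have "morse_index L x (2 * pi / \<omega>) = enat ((if radial_coeff < 0 then 1 else 0) + 2 * (1 - 1))"
      by (rule morse_index_eq) (use False in auto)
    then show ?thesis using False by (simp add: c_neg mode1)
  qed
qed

text \<open>\<open>f1 \<le> 0\<close> makes the bracket at order 0 nonnegative. The bracket of order
  1 exceeds it by the kinetic term and \<open>f2\<close> exceeds it by the completed square, so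
  these regions need no subdivision.\<close>

lemma mode_sign_nonneg_if_f1_nonpos:
  assumes "\<xi> > 0" "f1 \<xi> \<alpha> \<le> 0"
  shows "f2 \<xi> \<alpha> \<ge> 0" and "mode_sign \<xi> \<alpha> \<ge> 0"
proof -
  have "4 * (1 - \<xi>\<^sup>2)\<^sup>2 * arctan \<xi> \<ge> 0" "(1 + \<xi>\<^sup>2)\<^sup>2 * arctan \<xi> \<ge> 0"
    using assms by simp_all
  then show "f2 \<xi> \<alpha> \<ge> 0" "mode_sign \<xi> \<alpha> \<ge> 0"
    using assms(2) unfolding f1_eq mode_sign_eq by linarith+
qed

text \<open>The factor \<open>1 - \<xi>^2\<close> of \<open>mode_sign\<close> is negative here and
  positive in \<open>Omega2\<close>, which is why the bounds on \<open>\<alpha>\<close> point in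
  opposite directions.\<close>

lemma mode_sign_Omega1:
  assumes "(\<xi>, \<alpha>) \<in> Omega1"
  shows "mode_sign \<xi> \<alpha> < 0 \<longleftrightarrow> \<alpha> < 1 + 2 * (\<xi>\<^sup>2 - 1) * arctan \<xi> / \<xi>"
proof -
  have \<xi>: "\<xi> > 1" using assms by (simp add: Omega1_def)
  then have "1 - \<xi>\<^sup>2 < 0" by simp
  then have "mode_sign \<xi> \<alpha> < 0 \<longleftrightarrow> 0 < - 2 * (1 - \<xi>\<^sup>2) * arctan \<xi> - (\<alpha> - 1) * \<xi>"
    unfolding mode_sign_def by (auto simp only: mult_less_0_iff)
  also have "\<dots> \<longleftrightarrow> (\<alpha> - 1) * \<xi> < 2 * (\<xi>\<^sup>2 - 1) * arctan \<xi>"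
    by (simp add: algebra_simps)
  also have "\<dots> \<longleftrightarrow> \<alpha> - 1 < 2 * (\<xi>\<^sup>2 - 1) * arctan \<xi> / \<xi>"
    using \<xi> by (subst pos_less_divide_eq) auto
  finally show ?thesis by auto
qed

lemma mode_sign_Omega2:
  assumes "(\<xi>, \<alpha>) \<in> Omega2"
  shows "mode_sign \<xi> \<alpha> < 0 \<longleftrightarrow> 1 - 2 * (1 - \<xi>\<^sup>2) * arctan \<xi> / \<xi> < \<alpha>"
proof -
  have \<xi>: "0 < \<xi>" "\<xi> < 1" using assms by (auto simp: Omega2_def)
  then have "1 - \<xi>\<^sup>2 > 0" by (simp add: power_less_one_iff)
  then have "mode_sign \<xi> \<alpha> < 0 \<longleftrightarrow> - 2 * (1 - \<xi>\<^sup>2) * arctan \<xi> - (\<alpha> - 1) * \<xi> < 0"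
    unfolding mode_sign_def by (auto simp only: mult_less_0_iff)
  also have "\<dots> \<longleftrightarrow> (1 - \<alpha>) * \<xi> < 2 * (1 - \<xi>\<^sup>2) * arctan \<xi>"
    by (simp add: algebra_simps)
  also have "\<dots> \<longleftrightarrow> 1 - \<alpha> < 2 * (1 - \<xi>\<^sup>2) * arctan \<xi> / \<xi>"
    using \<xi> by (subst pos_less_divide_eq) auto
  finally show ?thesis by auto
qed

theorem theorem2:
  fixes \<alpha> \<xi>0 \<theta>0 \<omega> :: real
  assumes "\<alpha> \<noteq> 0"
    and "circular_solution conf_factor (arctan_potential \<alpha>) \<xi>0 \<theta>0 \<omega>"
  shows "let m = morse_index (polar_lagrangian conf_factor (arctan_potential \<alpha>))
                   (circular_curve \<xi>0 \<theta>0 \<omega>) (2 * pi / \<omega>) in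
    (\<xi>0, \<alpha>) \<in> Omega1 \<union> Omega2 \<and>
    0 \<le> m \<and> m \<le> 3 \<and>
    ((\<xi>0, \<alpha>) \<in> reg_m Omega1 \<union> reg_0 Omega1
        \<union> sub_10 (reg_pp Omega1) \<union> sub_10 (reg_p0 Omega1)
        \<union> reg_m Omega2 \<union> reg_0 Omega2
        \<union> sub_20 (reg_pp Omega2) \<union> sub_20 (reg_p0 Omega2)
      \<longrightarrow> m = 0) \<and>
    ((\<xi>0, \<alpha>) \<in> sub_10 (reg_pm Omega1) \<union> sub_20 (reg_pm Omega2)
      \<longrightarrow> m = 1) \<and>
    ((\<xi>0, \<alpha>) \<in> sub_11 (reg_pp Omega1) \<union> sub_11 (reg_p0 Omega1)
        \<union> sub_21 (reg_pp Omega2) \<union> sub_21 (reg_p0 Omega2)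
      \<longrightarrow> m = 2) \<and>
    ((\<xi>0, \<alpha>) \<in> sub_11 (reg_pm Omega1) \<union> sub_21 (reg_pm Omega2)
      \<longrightarrow> m = 3)"
proof -
  define m where "m = morse_index (polar_lagrangian conf_factor (arctan_potential \<alpha>))
    (circular_curve \<xi>0 \<theta>0 \<omega>) (2 * pi / \<omega>)"
  have \<xi>: "\<xi>0 > 0"
    using assms by (simp add: circular_solution_def)
  note region = circular_solution_morse_index(1) [OF assms]
  have m: "m = enat ((if f2 \<xi>0 \<alpha> < 0 then 1 else 0) + (if mode_sign \<xi>0 \<alpha> < 0 then 2 else 0))"
    unfolding m_def by (rule circular_solution_morse_index(2) [OF assms])
  have m0: "m = 0" if "f2 \<xi>0 \<alpha> \<ge> 0" "mode_sign \<xi>0 \<alpha> \<ge> 0"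
    using that by (simp add: m zero_enat_def)
  have m1: "m = 1" if "f2 \<xi>0 \<alpha> < 0" "mode_sign \<xi>0 \<alpha> \<ge> 0"
    using that by (simp add: m one_enat_def)
  have m2: "m = 2" if "f2 \<xi>0 \<alpha> \<ge> 0" "mode_sign \<xi>0 \<alpha> < 0"
    using that by (simp add: m numeral_eq_enat)
  have m3: "m = 3" if "f2 \<xi>0 \<alpha> < 0" "mode_sign \<xi>0 \<alpha> < 0"
    using that by (simp add: m numeral_eq_enat)
  note regs = reg_m_def reg_0_def reg_pp_def reg_p0_def reg_pm_def reg_p_def
    sub_10_def sub_11_def sub_20_def sub_21_def
  \<comment> \<open>Where \<open>f1 > 0\<close>, the second upper sign of a region is that of
    \<open>f2\<close> and its second lower index is 1 exactly when \<open>mode_sign\<close> is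
    negative; where \<open>f1 \<le> 0\<close>, both quantities are nonnegative.\<close>
  note nonpos = mode_sign_nonneg_if_f1_nonpos [OF \<xi>]
  have "m \<le> 3"
    by (simp add: m numeral_eq_enat)
  moreover have "m = 0" if "(\<xi>0, \<alpha>) \<in> reg_m Omega1 \<union> reg_0 Omega1
        \<union> sub_10 (reg_pp Omega1) \<union> sub_10 (reg_p0 Omega1)
        \<union> reg_m Omega2 \<union> reg_0 Omega2
        \<union> sub_20 (reg_pp Omega2) \<union> sub_20 (reg_p0 Omega2)"
  proof (rule m0)
    show "f2 \<xi>0 \<alpha> \<ge> 0"
      using that nonpos(1) [of \<alpha>] by (auto simp: regs)
    show "mode_sign \<xi>0 \<alpha> \<ge> 0"
      using that nonpos(2) [of \<alpha>] mode_sign_Omega1 [of \<xi>0 \<alpha>] mode_sign_Omega2 [of \<xi>0 \<alpha>]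
      by (auto simp: regs)
  qed
  moreover have "m = 1" if "(\<xi>0, \<alpha>) \<in> sub_10 (reg_pm Omega1) \<union> sub_20 (reg_pm Omega2)"
    using that mode_sign_Omega1 [of \<xi>0 \<alpha>] mode_sign_Omega2 [of \<xi>0 \<alpha>]
    by (intro m1) (auto simp: regs)
  moreover have "m = 2" if "(\<xi>0, \<alpha>) \<in> sub_11 (reg_pp Omega1) \<union> sub_11 (reg_p0 Omega1)
        \<union> sub_21 (reg_pp Omega2) \<union> sub_21 (reg_p0 Omega2)"
    using that mode_sign_Omega1 [of \<xi>0 \<alpha>] mode_sign_Omega2 [of \<xi>0 \<alpha>]
    by (intro m2) (auto simp: regs)
  moreover have "m = 3" if "(\<xi>0, \<alpha>) \<in> sub_11 (reg_pm Omega1) \<union> sub_21 (reg_pm Omega2)"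
    using that mode_sign_Omega1 [of \<xi>0 \<alpha>] mode_sign_Omega2 [of \<xi>0 \<alpha>]
    by (intro m3) (auto simp: regs)
  ultimately show ?thesis
    unfolding m_def [symmetric] Let_def using region by simp
qed

end
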